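(* Let $V$ be a finite dimensional Hilbert space, and let the tensor products $V^{\otimes n}$ be equipped with the induced Hilbert–Schmidt tensor norm. Let $1\leqslant a<b$ be integers, let $l_a\in\mathcal{L}_a(V)$ and $l_b\in\mathcal{L}_b(V)$ be homogeneous Lie polynomials of degrees $a$ and $b$ respectively, and let ${\bf X}_t=\exp(t(l_a+l_b))\in G^{(b)}(V)$, $0\leqslant t\leqslant1$. If $(b-a)/\gcd(a,b)$ is an odd integer, then $$L_b({\bf X})=\|l_b\|.$$
   Context: The Hilbert–Schmidt tensor norm on a tensor product of Hilbert spaces is induced by $\langle v_1\otimes w_1,v_2\otimes w_2\rangle=\langle v_1,v_2\rangle\langle w_1,w_2\rangle$. $T((V))=\prod_{n\geqslant0}V^{\otimes n}$ is the infinite tensor algebra, $T^{(n)}(V)=\oplus_{k=0}^nV^{\otimes k}$ the truncated one (products truncated at degree $n$). On both, $\exp(\xi)=\sum_{k\geqslant0}\xi^{\otimes k}/k!$ (truncated in $T^{(n)}(V)$). With $[\xi,\eta]=\xi\otimes\eta-\eta\otimes\xi$, the homogeneous Lie polynomials are $\mathcal{L}_1(V)=V$, $\mathcal{L}_{n+1}(V)=[V,\mathcal{L}_n(V)]$ (linear span of brackets); $\mathcal{L}^{(n)}(V)=\oplus_{k=1}^n\mathcal{L}_k(V)$ and $G^{(n)}(V)=\exp(\mathcal{L}^{(n)}(V))\subseteq T^{(n)}(V)$. For $p\geqslant1$, a $p$-rough path on $[0,T]$ is a continuous map ${\bf X}=(1,X^1,\dots,X^{\lfloor p\rfloor}):\{0\leqslant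 s\leqslant t\leqslant T\}\to T^{(\lfloor p\rfloor)}(V)$ with ${\bf X}_{s,u}={\bf X}_{s,t}\otimes{\bf X}_{t,u}$ and finite total $p$-variation $\sum_{k=1}^{\lfloor p\rfloor}\sup_{\mathcal{P}}\big(\sum_{t_i\in\mathcal{P}}\|X^k_{t_{i-1},t_i}\|^{p/k}\big)^{k/p}<\infty$; it is identified with the path ${\bf X}_t={\bf X}_{0,t}$ via ${\bf X}_{s,t}={\bf X}_s^{-1}\otimes{\bf X}_t$. By Lyons' extension theorem it extends uniquely to a multiplicative functional $\mathbb{X}_{s,t}=(1,X^1_{s,t},X^2_{s,t},\dots)\in T((V))$ all of whose truncations have finite total $p$-variation (same formula with $k$ up to the truncation degree); $S({\bf X})=\mathbb{X}_{0,T}$ is the signature. Here ${\bf X}_t=\exp(t(l_a+l_b))$ is regarded as a rough path with roughness $p=b$ and $T=1$. $L_p({\bf X})\triangleq\limsup_{n\to\infty}\big((n/p)!\,\|X^n_{0,T}\|\big)^{p/n}$, where $x!=\Gamma(x+1)$. *)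

theory Defs
  imports "HOL-Analysis.Analysis"
begin

section \<open>The algebra of tensor series\<close>

text \<open>
  For a finite-dimensional real Hilbert space \<open>V\<close> (the type \<open>'v\<close>), the inner product identifies
  the tensor power of degree \<open>n\<close> with the space of \<open>n\<close>-linear forms on \<open>V\<close>: the elementary tensor
  with factors \<open>v\<^sub>1, \<dots>, v\<^sub>n\<close> is the form \<open>[x\<^sub>1, \<dots>, x\<^sub>n] \<mapsto> (v\<^sub>1 \<bullet> x\<^sub>1) * \<dots> * (v\<^sub>n \<bullet> x\<^sub>n)\<close>.
  An element of the infinite tensor algebra \<open>T((V))\<close> is a family of such forms, one for each degree,
  i.e. a function on lists that is multilinear in the entries; its component of degree \<open>n\<close> is the
  restriction to lists of length \<open>n\<close>.
\<close>

typedef (overloaded) ('v::real_inner) tensor_series =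
  "{f :: 'v list \<Rightarrow> real. \<forall>us vs. linear (\<lambda>x. f (us @ x # vs))}"
  morphisms form Abs_tensor_series
  by (rule exI[of _ "\<lambda>_. 0"]) (simp add: linear_zero)

setup_lifting type_definition_tensor_series

lemma linear_form: "linear (\<lambda>x. form \<xi> (us @ x # vs))"
  using form[of \<xi>] by simp

lemma tensor_series_eqI: "(\<And>ws. form \<xi> ws = form \<eta> ws) \<Longrightarrow> \<xi> = \<eta>"
  by (simp add: form_inject[symmetric] fun_eq_iff)

lemma linear_mult_right: "linear f \<Longrightarrow> linear (\<lambda>x. f x * (c::real))"
  by (rule linearI) (simp_all add: linear_add linear_cmul distrib_right)

lemma linear_mult_left: "linear f \<Longrightarrow> linear (\<lambda>x. (c::real) * f x)"
  by (rule linearI) (simp_all add: linear_add linear_cmul distrib_left)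

lemma linear_if_const: "linear f \<Longrightarrow> linear (\<lambda>x. if c then f x else (0::real))"
  by (cases c) (simp_all add: linear_zero)

lemma linear_concatenation_product:
  fixes f g :: "'v::real_vector list \<Rightarrow> real"
  assumes f: "\<forall>us vs. linear (\<lambda>x. f (us @ x # vs))"
    and g: "\<forall>us vs. linear (\<lambda>x. g (us @ x # vs))"
  shows "linear (\<lambda>x. \<Sum>k\<le>length (us @ x # vs).
           f (take k (us @ x # vs)) * g (drop k (us @ x # vs)))"
proof -
  have "linear (\<lambda>x. f (take k (us @ x # vs)) * g (drop k (us @ x # vs)))" for k
  proof (cases "k \<le> length us")
    case True
    have "linear (\<lambda>x. f (take k us) * g (drop k us @ x # vs))"
      using g by (intro linear_mult_left) blast
    with True show ?thesis by simp
  next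
    case False
    then obtain m where m: "k - length us = Suc m"
      by (metis Suc_diff_Suc not_le)
    have "linear (\<lambda>x. f (us @ x # take m vs) * g (drop m vs))"
      using f by (intro linear_mult_right) blast
    with False m show ?thesis by simp
  qed
  then have "linear (\<lambda>x. \<Sum>k\<le>Suc (length us + length vs).
           f (take k (us @ x # vs)) * g (drop k (us @ x # vs)))"
    by (intro linear_compose_sum) blast
  then show ?thesis by simp
qed

instantiation tensor_series :: (real_inner) real_algebra_1
begin

lift_definition zero_tensor_series :: "'a tensor_series" is "\<lambda>_. 0"
  by (simp add: linear_zero)

lift_definition one_tensor_series :: "'a tensor_series" is "\<lambda>ws. if ws = [] then 1 else 0"
  by (simp add: linear_zero)

lift_definition plus_tensor_series :: "'a tensor_series \<Rightarrow> 'a tensor_series \<Rightarrow> 'a tensor_series"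
  is "\<lambda>f g ws. f ws + g ws"
  by (simp add: linear_compose_add)

lift_definition minus_tensor_series :: "'a tensor_series \<Rightarrow> 'a tensor_series \<Rightarrow> 'a tensor_series"
  is "\<lambda>f g ws. f ws - g ws"
  by (simp add: linear_compose_sub)

lift_definition uminus_tensor_series :: "'a tensor_series \<Rightarrow> 'a tensor_series"
  is "\<lambda>f ws. - f ws"
  by (simp add: linear_compose_neg)

lift_definition scaleR_tensor_series :: "real \<Rightarrow> 'a tensor_series \<Rightarrow> 'a tensor_series"
  is "\<lambda>c f ws. c * f ws"
  by (simp add: linear_mult_left)

text \<open>The tensor product of forms of degrees \<open>k\<close> and \<open>m\<close> evaluates the first on the first \<open>k\<close>
  arguments and the second on the remaining \<open>m\<close>.\<close>

lift_definition times_tensor_series :: "'a tensor_series \<Rightarrow> 'a tensor_series \<Rightarrow> 'a tensor_series"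
  is "\<lambda>f g ws. \<Sum>k\<le>length ws. f (take k ws) * g (drop k ws)"
  by (intro allI linear_concatenation_product)

instance
proof
  fix x y z :: "'a tensor_series" and r s :: real
  show "x + y + z = x + (y + z)" "x + y = y + x" "0 + x = x" "- x + x = 0" "x - y = x + - y"
    by (transfer; simp add: add_ac)+
  show "r *\<^sub>R (x + y) = r *\<^sub>R x + r *\<^sub>R y" "(r + s) *\<^sub>R x = r *\<^sub>R x + s *\<^sub>R x"
    "r *\<^sub>R s *\<^sub>R x = (r * s) *\<^sub>R x" "1 *\<^sub>R x = x"
    by (transfer; simp add: algebra_simps)+
  show "(x + y) * z = x * z + y * z" "x * (y + z) = x * y + x * z"
    "r *\<^sub>R x * y = r *\<^sub>R (x * y)" "x * r *\<^sub>R y = r *\<^sub>R (x * y)"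
    by (transfer; simp add: algebra_simps sum.distrib sum_distrib_left)+
  show "(0 :: 'a tensor_series) \<noteq> 1"
    by transfer (auto simp: fun_eq_iff)
  show "1 * x = x"
  proof (transfer, rule ext)
    fix f :: "'a list \<Rightarrow> real" and ws
    have "(\<Sum>k\<le>length ws. (if take k ws = [] then 1 else 0) * f (drop k ws))
        = (\<Sum>k\<le>length ws. if k = 0 then f ws else 0)"
      by (intro sum.cong) auto
    then show "(\<Sum>k\<le>length ws. (if take k ws = [] then 1 else 0) * f (drop k ws)) = f ws"
      by simp
  qed
  show "x * 1 = x"
  proof (transfer, rule ext)
    fix f :: "'a list \<Rightarrow> real" and ws
    have "(\<Sum>k\<le>length ws. f (take k ws) * (if drop k ws = [] then 1 else 0))
        = (\<Sum>k\<le>length ws. if k = length ws then f ws else 0)"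
      by (intro sum.cong) auto
    then show "(\<Sum>k\<le>length ws. f (take k ws) * (if drop k ws = [] then 1 else 0)) = f ws"
      by simp
  qed
  show "x * y * z = x * (y * z)"
  proof (transfer, rule ext)
    fix f g h :: "'a list \<Rightarrow> real" and ws
    have reindex: "(\<Sum>j\<le>n. \<Sum>i\<le>j. F i (j - i) (n - j)) = (\<Sum>j\<le>n. \<Sum>i\<le>n - j. F j i (n - j - i))"
      for F :: "nat \<Rightarrow> nat \<Rightarrow> nat \<Rightarrow> real" and n
    proof -
      have "(\<Sum>j\<le>k. \<Sum>i\<le>j. F i (j - i) (n - j)) = (\<Sum>j\<le>k. \<Sum>i\<le>k - j. F j i (n - j - i))" for k
        by (induct k) (simp_all add: Suc_diff_le sum.distrib add.assoc)
      then show ?thesis .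
    qed
    define F where "F i j k = f (take i ws) * g (take j (drop i ws)) * h (drop (length ws - k) ws)"
      for i j k
    have "(\<Sum>k\<le>length ws. (\<Sum>j\<le>length (take k ws). f (take j (take k ws)) * g (drop j (take k ws)))
            * h (drop k ws))
        = (\<Sum>k\<le>length ws. \<Sum>j\<le>k. F j (k - j) (length ws - k))"
      by (intro sum.cong) (auto simp: F_def sum_distrib_right min_def drop_take intro!: sum.cong)
    also have "\<dots> = (\<Sum>j\<le>length ws. \<Sum>i\<le>length ws - j. F j i (length ws - j - i))"
      by (rule reindex)
    also have "\<dots> = (\<Sum>k\<le>length ws. f (take k ws) *
        (\<Sum>j\<le>length (drop k ws). g (take j (drop k ws)) * h (drop j (drop k ws))))"
      by (intro sum.cong)
         (auto simp: F_def sum_distrib_left mult.assoc add.commute intro!: sum.cong arg_cong[of _ _ h]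
               arg_cong2[where f = drop])
    finally show "(\<Sum>k\<le>length ws. (\<Sum>j\<le>length (take k ws). f (take j (take k ws)) * g (drop j (take k ws)))
            * h (drop k ws)) = \<dots>" .
  qed
qed

end

lemmas form_simps = zero_tensor_series.rep_eq one_tensor_series.rep_eq plus_tensor_series.rep_eq
  minus_tensor_series.rep_eq uminus_tensor_series.rep_eq scaleR_tensor_series.rep_eq
  times_tensor_series.rep_eq


lemma linear_form_vec: "linear (\<lambda>x. case us @ x # vs of [x] \<Rightarrow> v \<bullet> x | _ \<Rightarrow> (0::real))"
proof (cases "us = [] \<and> vs = []")
  case True
  then show ?thesis
    by (simp add: bounded_linear.linear bounded_linear_inner_right)
next
  case False
  then have "(\<lambda>x. case us @ x # vs of [x] \<Rightarrow> v \<bullet> x | _ \<Rightarrow> (0::real)) = (\<lambda>x. 0)"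
    by (auto simp: fun_eq_iff append_eq_Cons_conv split: list.split)
  then show ?thesis
    by (simp add: linear_zero)
qed

lift_definition tensor_vec :: "'v::real_inner \<Rightarrow> 'v tensor_series"
  is "\<lambda>v ws. case ws of [x] \<Rightarrow> v \<bullet> x | _ \<Rightarrow> 0"
  by (rule linear_form_vec)

definition tensor_power :: "nat \<Rightarrow> 'v::real_inner tensor_series set"
  where "tensor_power n = {\<xi>. \<forall>ws. length ws \<noteq> n \<longrightarrow> form \<xi> ws = 0}"

lift_definition trunc :: "nat \<Rightarrow> 'v::real_inner tensor_series \<Rightarrow> 'v tensor_series"
  is "\<lambda>n f ws. if length ws \<le> n then f ws else 0"
  by (simp add: linear_if_const)

text \<open>The truncated tensor algebra is realised inside \<open>T((V))\<close>; its product is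
  \<open>\<lambda>\<xi> \<eta>. trunc n (\<xi> * \<eta>)\<close>.\<close>

definition truncated_algebra :: "nat \<Rightarrow> 'v::real_inner tensor_series set"
  where "truncated_algebra n = {\<xi>. trunc n \<xi> = \<xi>}"

lemma trunc_mult: "trunc n (trunc n \<xi> * trunc n \<eta>) = trunc n (\<xi> * \<eta>)"
  by (rule tensor_series_eqI) (auto simp: trunc.rep_eq form_simps intro!: sum.cong)


section \<open>The exponential\<close>

lemma summable_form_exp: "summable (\<lambda>k. form (\<xi> ^ k) ws / fact k)"
proof -
  define S where "S = (\<lambda>(i, j). take j (drop i ws)) ` ({..length ws} \<times> {..length ws})"
  define C where "C = (\<Sum>u\<in>S. \<bar>form \<xi> u\<bar>)"
  define K where "K = C * (real (length ws) + 1)"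
  have fin: "finite S" by (simp add: S_def)
  have C: "\<bar>form \<xi> u\<bar> \<le> C" if "u \<in> S" for u
    unfolding C_def using member_le_sum[OF that _ fin, of "\<lambda>u. \<bar>form \<xi> u\<bar>"] by simp
  have "C \<ge> 0" by (simp add: C_def sum_nonneg)
  then have "K \<ge> 0" by (simp add: K_def)
  have S_len: "length u \<le> length ws" if "u \<in> S" for u
    using that by (auto simp: S_def)
  have S_I: "take j (drop i ws) \<in> S" for i j
  proof -
    have "take j (drop i ws) = take (min j (length ws)) (drop (min i (length ws)) ws)"
      by (auto simp: min_def)
    then show ?thesis unfolding S_def by (intro image_eqI[where x = "(min i (length ws), min j (length ws))"]) auto
  qed
  have S_take: "take m u \<in> S" and S_drop: "drop m u \<in> S" if "u \<in> S" for u m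
  proof -
    from that obtain i j where "u = take j (drop i ws)" unfolding S_def by auto
    then have "take m u = take (min m j) (drop i ws)" "drop m u = take (j - m) (drop (m + i) ws)"
      by (simp_all only: take_take drop_take drop_drop)
    then show "take m u \<in> S" "drop m u \<in> S" using S_I by simp_all
  qed
  have bound: "\<bar>form (\<xi> ^ k) u\<bar> \<le> K ^ k" if "u \<in> S" for k u
    using that
  proof (induction k arbitrary: u)
    case 0
    then show ?case by (simp add: form_simps)
  next
    case (Suc k)
    have "\<bar>form (\<xi> ^ Suc k) u\<bar> \<le> (\<Sum>m\<le>length u. \<bar>form \<xi> (take m u) * form (\<xi> ^ k) (drop m u)\<bar>)"
      by (simp add: form_simps sum_abs)
    also have "\<dots> \<le> (\<Sum>m\<le>length u. C * K ^ k)"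
      unfolding abs_mult using \<open>C \<ge> 0\<close>
      by (intro sum_mono mult_mono C Suc.IH S_take S_drop Suc.prems) auto
    also have "\<dots> = (real (length u) + 1) * (C * K ^ k)"
      by simp
    also have "\<dots> \<le> (real (length ws) + 1) * (C * K ^ k)"
      using S_len[OF Suc.prems] \<open>C \<ge> 0\<close> \<open>K \<ge> 0\<close> by (intro mult_right_mono) auto
    also have "\<dots> = K ^ Suc k" by (simp add: K_def)
    finally show ?case .
  qed
  have "ws \<in> S" using S_I[of "length ws" 0] by simp
  have "summable (\<lambda>k. K ^ k / fact k)"
    using summable_exp_generic[of K] by (simp add: scaleR_conv_of_real field_simps)
  then show ?thesis
  proof (rule summable_comparison_test')
    fix k
    show "norm (form (\<xi> ^ k) ws / fact k) \<le> K ^ k / fact k"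
      using bound[OF \<open>ws \<in> S\<close>, of k] by (simp add: divide_right_mono)
  qed
qed

definition tensor_exp :: "'v::real_inner tensor_series \<Rightarrow> 'v tensor_series"
  where "tensor_exp \<xi> = Abs_tensor_series (\<lambda>ws. \<Sum>k. form (\<xi> ^ k) ws / fact k)"

lemma form_tensor_exp: "form (tensor_exp \<xi>) ws = (\<Sum>k. form (\<xi> ^ k) ws / fact k)"
proof -
  have "linear (\<lambda>x. \<Sum>k. form (\<xi> ^ k) (us @ x # vs) / fact k)" for us vs
    by (rule linearI)
       (simp_all add: linear_add[OF linear_form] linear_cmul[OF linear_form] add_divide_distrib
         suminf_add[OF summable_form_exp summable_form_exp] suminf_mult[OF summable_form_exp, symmetric])
  then show ?thesis
    unfolding tensor_exp_def by (subst Abs_tensor_series_inverse) auto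
qed

text \<open>The powers formed with the truncated product are the truncations of the powers in \<open>T((V))\<close>,
  so the exponential of the truncated algebra is the truncation of the one above.\<close>

definition truncated_exp :: "nat \<Rightarrow> 'v::real_inner tensor_series \<Rightarrow> 'v tensor_series"
  where "truncated_exp n \<xi> = trunc n (tensor_exp \<xi>)"


section \<open>Lie polynomials\<close>

definition bracket :: "'v::real_inner tensor_series \<Rightarrow> 'v tensor_series \<Rightarrow> 'v tensor_series"
  where "bracket \<xi> \<eta> = \<xi> * \<eta> - \<eta> * \<xi>"

fun homogeneous_lie :: "nat \<Rightarrow> 'v::real_inner tensor_series set"
  where
    "homogeneous_lie 0 = {0}"
  | "homogeneous_lie (Suc 0) = range tensor_vec"
  | "homogeneous_lie (Suc (Suc n)) = span {bracket (tensor_vec v) l | v l. l \<in> homogeneous_lie (Suc n)}"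

definition lie_polynomials :: "nat \<Rightarrow> 'v::real_inner tensor_series set"
  where "lie_polynomials n = {\<Sum>k=1..n. l k | l. \<forall>k\<in>{1..n}. l k \<in> homogeneous_lie k}"

definition free_nilpotent_group :: "nat \<Rightarrow> 'v::real_inner tensor_series set"
  where "free_nilpotent_group n = truncated_exp n ` lie_polynomials n"

lemma tensor_vec_add: "tensor_vec (v + w) = tensor_vec v + tensor_vec w"
  by (rule tensor_series_eqI) (auto simp: form_simps tensor_vec.rep_eq inner_add_left split: list.split)

lemma tensor_vec_scaleR: "tensor_vec (c *\<^sub>R v) = c *\<^sub>R tensor_vec v"
  by (rule tensor_series_eqI) (auto simp: form_simps tensor_vec.rep_eq split: list.split)

lemma subspace_homogeneous_lie: "subspace (homogeneous_lie n :: 'v::real_inner tensor_series set)"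
proof (cases n rule: homogeneous_lie.cases)
  case 2
  have "linear (tensor_vec :: 'v \<Rightarrow> 'v tensor_series)"
    by (rule linearI) (simp_all add: tensor_vec_add tensor_vec_scaleR)
  then show ?thesis using linear_subspace_image[OF _ subspace_UNIV] 2 by auto
qed (simp_all add: subspace_single_0)

lemma truncated_exp_mem_free_nilpotent_group:
  assumes "1 \<le> a" "a < b" "l\<^sub>a \<in> homogeneous_lie a" "l\<^sub>b \<in> homogeneous_lie b"
  shows "truncated_exp b (t *\<^sub>R (l\<^sub>a + l\<^sub>b)) \<in> free_nilpotent_group b"
proof -
  define l where "l k = (if k = a then t *\<^sub>R l\<^sub>a else 0) + (if k = b then t *\<^sub>R l\<^sub>b else 0)" for k
  have "t *\<^sub>R (l\<^sub>a + l\<^sub>b) = (\<Sum>k=1..b. l k)"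
    using assms(1,2) by (simp add: l_def sum.distrib scaleR_add_right)
  moreover have "l k \<in> homogeneous_lie k" for k
  proof -
    have "t *\<^sub>R l\<^sub>a \<in> homogeneous_lie a" "t *\<^sub>R l\<^sub>b \<in> homogeneous_lie b" "0 \<in> homogeneous_lie k"
      using assms(3,4) by (auto intro: real_vector.subspace_scale real_vector.subspace_0 subspace_homogeneous_lie)
    with assms(2) show ?thesis by (auto simp: l_def)
  qed
  ultimately show ?thesis
    unfolding free_nilpotent_group_def lie_polynomials_def by blast
qed


section \<open>The Hilbert--Schmidt norm\<close>

definition orthonormal_basis :: "'v::real_inner set \<Rightarrow> bool"
  where "orthonormal_basis B \<longleftrightarrow>
    finite B \<and> pairwise orthogonal B \<and> (\<forall>e\<in>B. norm e = 1) \<and> span B = UNIV"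

text \<open>The inner product and the norm of the degree \<open>n\<close> components. For finite-dimensional \<open>V\<close> they
  do not depend on the choice of the orthonormal basis, and the inner product is the one induced
  from \<open>V\<close>; see \<open>hs_inner_eq\<close>, \<open>hs_inner_vec\<close> and \<open>hs_inner_mult\<close>.\<close>

definition hs_inner :: "nat \<Rightarrow> 'v::real_inner tensor_series \<Rightarrow> 'v tensor_series \<Rightarrow> real"
  where "hs_inner n \<xi> \<eta> =
    (\<Sum>ws | set ws \<subseteq> (SOME B. orthonormal_basis B) \<and> length ws = n. form \<xi> ws * form \<eta> ws)"

definition hs_norm :: "nat \<Rightarrow> 'v::real_inner tensor_series \<Rightarrow> real"
  where "hs_norm n \<xi> = sqrt (hs_inner n \<xi> \<xi>)"

lemma orthonormal_basis_exists:
  assumes "\<exists>B :: 'v::real_inner set. finite B \<and> span B = UNIV"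
  shows "\<exists>B :: 'v set. orthonormal_basis B"
proof -
  obtain B :: "'v set" where "finite B" "span B = UNIV" using assms by blast
  then obtain C :: "'v set" where C: "finite C" "span C = UNIV" "pairwise orthogonal C"
    using basis_orthogonal[of B] by auto
  define D where "D = (\<lambda>c. c /\<^sub>R norm c) ` (C - {0})"
  have "finite D" using C by (simp add: D_def)
  moreover have "pairwise orthogonal D"
    using C(3) unfolding D_def pairwise_def by (force simp: orthogonal_def)
  moreover have "\<forall>e\<in>D. norm e = 1" by (auto simp: D_def)
  moreover have "C \<subseteq> span D"
  proof
    fix c assume "c \<in> C"
    show "c \<in> span D"
    proof (cases "c = 0")
      case True
      then show ?thesis by (simp add: span_zero)
    next
      case False
      then have "c /\<^sub>R norm c \<in> span D" using \<open>c \<in> C\<close> by (intro span_base) (auto simp: D_def)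
      then have "norm c *\<^sub>R (c /\<^sub>R norm c) \<in> span D" by (rule span_scale)
      then show ?thesis using False by simp
    qed
  qed
  then have "span D = UNIV" using C(2) by (metis span_minimal subspace_span top.extremum_uniqueI)
  ultimately show ?thesis by (auto simp: orthonormal_basis_def)
qed

lemma orthonormal_basis_expansion:
  assumes "orthonormal_basis B"
  shows "(\<Sum>e\<in>B. (x \<bullet> e) *\<^sub>R e) = x"
proof -
  have B: "finite B" "pairwise orthogonal B" "\<And>e. e \<in> B \<Longrightarrow> e \<bullet> e = 1" "span B = UNIV"
    using assms by (auto simp: orthonormal_basis_def dot_square_norm)
  have "x \<in> span B" using B by simp
  then show ?thesis
  proof (induction rule: span_induct_alt)
    case base
    then show ?case by simp
  next
    case (step c b y)
    have "(\<Sum>e\<in>B. (b \<bullet> e) *\<^sub>R e) = (\<Sum>e\<in>B. if e = b then b else 0)"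
      using B step(1) by (intro sum.cong) (auto simp: pairwise_def orthogonal_def)
    also have "\<dots> = b" using B step(1) by simp
    finally show ?case using step(2)
      by (simp add: inner_add_left scaleR_add_left sum.distrib flip: scaleR_scaleR scaleR_sum_right)
  qed
qed

lemma parseval_linear:
  fixes f g :: "'v::real_inner \<Rightarrow> real"
  assumes "orthonormal_basis B" "orthonormal_basis C" "linear f" "linear g"
  shows "(\<Sum>e\<in>B. f e * g e) = (\<Sum>c\<in>C. f c * g c)"
proof -
  have expand: "h x = (\<Sum>d\<in>D. (x \<bullet> d) * h d)" if "linear h" "orthonormal_basis D"
    for h :: "'v \<Rightarrow> real" and x D
  proof -
    have "h x = h (\<Sum>d\<in>D. (x \<bullet> d) *\<^sub>R d)"
      using orthonormal_basis_expansion[OF that(2)] by simp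
    then show ?thesis by (simp add: linear_sum[OF that(1)] linear_cmul[OF that(1)])
  qed
  have "(\<Sum>e\<in>B. f e * g e) = (\<Sum>e\<in>B. \<Sum>c\<in>C. f e * ((e \<bullet> c) * g c))"
    by (subst expand[OF assms(4,2)]) (simp add: sum_distrib_left)
  also have "\<dots> = (\<Sum>c\<in>C. \<Sum>e\<in>B. f e * ((e \<bullet> c) * g c))"
    by (rule sum.swap)
  also have "\<dots> = (\<Sum>c\<in>C. (\<Sum>e\<in>B. (c \<bullet> e) * f e) * g c)"
    by (intro sum.cong refl) (simp add: sum_distrib_left inner_commute mult_ac)
  also have "\<dots> = (\<Sum>c\<in>C. f c * g c)"
    by (subst expand[OF assms(3,1), symmetric]) simp
  finally show ?thesis .
qed

lemma sum_words_Suc: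
  assumes "finite B"
  shows "(\<Sum>ws | set ws \<subseteq> B \<and> length ws = Suc n. F ws)
       = (\<Sum>e\<in>B. \<Sum>ws | set ws \<subseteq> B \<and> length ws = n. F (e # ws))"
proof -
  have "(\<Sum>e\<in>B. \<Sum>ws | set ws \<subseteq> B \<and> length ws = n. F (e # ws))
      = (\<Sum>(e, ws)\<in>B \<times> {ws. set ws \<subseteq> B \<and> length ws = n}. F (e # ws))"
    using assms by (simp add: sum.cartesian_product)
  also have "\<dots> = (\<Sum>ws | set ws \<subseteq> B \<and> length ws = Suc n. F ws)"
    by (rule sum.reindex_bij_witness[where i = "\<lambda>ws. (hd ws, tl ws)" and j = "\<lambda>(e, ws). e # ws"])
       (auto simp: length_Suc_conv)
  finally show ?thesis by simp
qed

lemma sum_words_append: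
  assumes "finite B"
  shows "(\<Sum>ws | set ws \<subseteq> B \<and> length ws = m + n. F ws)
       = (\<Sum>us | set us \<subseteq> B \<and> length us = m. \<Sum>vs | set vs \<subseteq> B \<and> length vs = n. F (us @ vs))"
proof (induction m arbitrary: F)
  case 0
  have "{us. set us \<subseteq> B \<and> length us = 0} = {[]}" by auto
  then show ?case by simp
next
  case (Suc m)
  then show ?case by (simp add: sum_words_Suc[OF assms])
qed

lemma sum_words_basis_indep:
  fixes f g :: "'v::real_inner list \<Rightarrow> real"
  assumes B: "orthonormal_basis B" and C: "orthonormal_basis C"
    and "\<forall>us vs. linear (\<lambda>x. f (us @ x # vs))" "\<forall>us vs. linear (\<lambda>x. g (us @ x # vs))"
  shows "(\<Sum>ws | set ws \<subseteq> B \<and> length ws = n. f ws * g ws)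
       = (\<Sum>ws | set ws \<subseteq> C \<and> length ws = n. f ws * g ws)"
  using assms(3,4)
proof (induction n arbitrary: f g)
  case 0
  have "{ws. set ws \<subseteq> D \<and> length ws = 0} = {[]}" for D :: "'v set" by auto
  then show ?case by simp
next
  case (Suc n)
  have fin: "finite B" "finite C" using B C by (auto simp: orthonormal_basis_def)
  have lin: "linear (\<lambda>x. h (x # vs))" "\<forall>us vs. linear (\<lambda>x. h (e # us @ x # vs))"
    if "\<forall>us vs. linear (\<lambda>x. h (us @ x # vs))" for h :: "'v list \<Rightarrow> real" and e vs
    using spec[OF spec[OF that, of "[]"], of vs] spec[OF that, of "e # _"] by auto
  have "(\<Sum>ws | set ws \<subseteq> B \<and> length ws = Suc n. f ws * g ws)
      = (\<Sum>e\<in>B. \<Sum>ws | set ws \<subseteq> B \<and> length ws = n. f (e # ws) * g (e # ws))"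
    by (rule sum_words_Suc[OF fin(1)])
  also have "\<dots> = (\<Sum>e\<in>B. \<Sum>ws | set ws \<subseteq> C \<and> length ws = n. f (e # ws) * g (e # ws))"
    using lin(2)[OF Suc.prems(1)] lin(2)[OF Suc.prems(2)]
    by (intro sum.cong refl Suc.IH[of "\<lambda>ws. f (_ # ws)" "\<lambda>ws. g (_ # ws)"])
  also have "\<dots> = (\<Sum>ws | set ws \<subseteq> C \<and> length ws = n. \<Sum>e\<in>B. f (e # ws) * g (e # ws))"
    by (rule sum.swap)
  also have "\<dots> = (\<Sum>ws | set ws \<subseteq> C \<and> length ws = n. \<Sum>e\<in>C. f (e # ws) * g (e # ws))"
    by (intro sum.cong refl parseval_linear[OF B C] lin Suc.prems)
  also have "\<dots> = (\<Sum>e\<in>C. \<Sum>ws | set ws \<subseteq> C \<and> length ws = n. f (e # ws) * g (e # ws))"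
    by (rule sum.swap)
  also have "\<dots> = (\<Sum>ws | set ws \<subseteq> C \<and> length ws = Suc n. f ws * g ws)"
    by (rule sum_words_Suc[OF fin(2), symmetric])
  finally show ?case .
qed

lemma hs_inner_eq:
  assumes "orthonormal_basis B"
  shows "hs_inner n \<xi> \<eta> = (\<Sum>ws | set ws \<subseteq> B \<and> length ws = n. form \<xi> ws * form \<eta> ws)"
  unfolding hs_inner_def using assms linear_form
  by (intro sum_words_basis_indep someI[of orthonormal_basis]) auto

lemma hs_inner_vec:
  assumes "orthonormal_basis (B :: 'v::real_inner set)"
  shows "hs_inner 1 (tensor_vec (v :: 'v)) (tensor_vec w) = v \<bullet> w"
proof -
  have "finite B" using assms by (simp add: orthonormal_basis_def)
  moreover have "{ws. set ws \<subseteq> B \<and> length ws = 0} = {[]}" by auto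
  ultimately have "hs_inner 1 (tensor_vec v) (tensor_vec w) = (\<Sum>e\<in>B. (v \<bullet> e) * (w \<bullet> e))"
    unfolding hs_inner_eq[OF assms] One_nat_def by (simp add: sum_words_Suc tensor_vec.rep_eq)
  also have "\<dots> = v \<bullet> (\<Sum>e\<in>B. (w \<bullet> e) *\<^sub>R e)"
    by (simp add: inner_sum_right mult.commute)
  finally show ?thesis by (simp add: orthonormal_basis_expansion[OF assms])
qed

lemma form_mult_append:
  assumes "\<xi> \<in> tensor_power m" "length us = m"
  shows "form (\<xi> * \<eta>) (us @ vs) = form \<xi> us * form \<eta> vs"
proof -
  have "form (\<xi> * \<eta>) (us @ vs)
      = (\<Sum>k\<le>length (us @ vs). if k = m then form \<xi> us * form \<eta> vs else 0)"
    unfolding form_simps using assms by (intro sum.cong) (auto simp: tensor_power_def)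
  then show ?thesis using assms by simp
qed

lemma hs_inner_mult:
  assumes "orthonormal_basis (B :: 'v::real_inner set)"
    and "\<xi> \<in> tensor_power m" "\<xi>' \<in> tensor_power m"
  shows "hs_inner (m + n) (\<xi> * \<eta>) (\<xi>' * \<eta>' :: 'v tensor_series) = hs_inner m \<xi> \<xi>' * hs_inner n \<eta> \<eta>'"
proof -
  have "finite B" using assms by (simp add: orthonormal_basis_def)
  then have "hs_inner (m + n) (\<xi> * \<eta>) (\<xi>' * \<eta>')
      = (\<Sum>us | set us \<subseteq> B \<and> length us = m. \<Sum>vs | set vs \<subseteq> B \<and> length vs = n.
           (form \<xi> us * form \<xi>' us) * (form \<eta> vs * form \<eta>' vs))"
    unfolding hs_inner_eq[OF assms(1)] sum_words_append[OF \<open>finite B\<close>]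
    by (intro sum.cong refl) (simp add: form_mult_append[OF assms(2)] form_mult_append[OF assms(3)])
  also have "\<dots> = hs_inner m \<xi> \<xi>' * hs_inner n \<eta> \<eta>'"
    unfolding hs_inner_eq[OF assms(1)] by (simp add: sum_product)
  finally show ?thesis .
qed

text \<open>The elementary tensors span the space of multilinear forms.\<close>

lemma form_expansion:
  assumes B: "orthonormal_basis (B :: 'v::real_inner set)"
    and "\<forall>us vs. linear (\<lambda>x. f (us @ x # vs))"
  shows "f us = (\<Sum>ws | set ws \<subseteq> B \<and> length ws = length us. f ws * form (prod_list (map tensor_vec ws)) us)"
  using assms(2)
proof (induction us arbitrary: f)
  case Nil
  have "{ws. set ws \<subseteq> B \<and> length ws = 0} = {[]}" by auto
  then show ?case by (simp add: form_simps)
next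
  case (Cons x us)
  have fin: "finite B" using B by (simp add: orthonormal_basis_def)
  have lin: "linear (\<lambda>x. f (x # us))" "\<forall>us vs. linear (\<lambda>x. f (e # us @ x # vs))" for e
    using spec[OF spec[OF Cons.prems, of "[]"], of us] spec[OF Cons.prems, of "e # _"] by auto
  have degree1: "tensor_vec e \<in> tensor_power 1" for e :: 'v
    by (auto simp: tensor_power_def tensor_vec.rep_eq split: list.split)
  have form_Cons: "form (tensor_vec e * \<eta>) (x # us) = (x \<bullet> e) * form \<eta> us" for e and \<eta> :: "'v tensor_series"
    using form_mult_append[OF degree1, of "[x]" e \<eta> us] by (simp add: tensor_vec.rep_eq inner_commute)
  have "f (x # us) = f ((\<Sum>e\<in>B. (x \<bullet> e) *\<^sub>R e) # us)"
    by (simp add: orthonormal_basis_expansion[OF B])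
  also have "\<dots> = (\<Sum>e\<in>B. (x \<bullet> e) * f (e # us))"
    by (simp add: linear_sum[OF lin(1)] linear_cmul[OF lin(1)])
  also have "\<dots> = (\<Sum>e\<in>B. (x \<bullet> e) * (\<Sum>ws | set ws \<subseteq> B \<and> length ws = length us.
      f (e # ws) * form (prod_list (map tensor_vec ws)) us))"
    using Cons.IH[OF lin(2)] by simp
  also have "\<dots> = (\<Sum>ws | set ws \<subseteq> B \<and> length ws = length (x # us).
      f ws * form (prod_list (map tensor_vec ws)) (x # us))"
    by (simp add: sum_words_Suc[OF fin] form_Cons sum_distrib_left mult_ac)
  finally show ?case .
qed

lemma form_sum: "form (\<Sum>i\<in>A. g i) us = (\<Sum>i\<in>A. form (g i) us)"
  by (induction A rule: infinite_finite_induct) (simp_all add: form_simps)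

lemma form_prod_vec_eq_0: "length us \<noteq> length ws \<Longrightarrow> form (prod_list (map tensor_vec ws)) us = 0"
proof (induction ws arbitrary: us)
  case (Cons w ws)
  have zero: "form (tensor_vec w) zs = 0" if "length zs \<noteq> 1" for zs
    using that by (auto simp: tensor_vec.rep_eq split: list.split)
  from Cons have "form (tensor_vec w) (take k us) * form (prod_list (map tensor_vec ws)) (drop k us) = 0"
    if "k \<le> length us" for k
  proof (cases "k = 1")
    case True
    then show ?thesis using Cons that by simp
  next
    case False
    then show ?thesis using that by (simp add: zero)
  qed
  then show ?case by (auto simp: form_simps intro!: sum.neutral)
qed (simp add: form_simps)

lemma tensor_power_expansion:
  assumes "orthonormal_basis (B :: 'v::real_inner set)" "\<xi> \<in> tensor_power n"
  shows "\<xi> = (\<Sum>ws | set ws \<subseteq> B \<and> length ws = n. form \<xi> ws *\<^sub>R prod_list (map tensor_vec ws))"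
proof (rule tensor_series_eqI)
  fix us
  show "form \<xi> us = form (\<Sum>ws | set ws \<subseteq> B \<and> length ws = n. form \<xi> ws *\<^sub>R prod_list (map tensor_vec ws)) us"
  proof (cases "length us = n")
    case True
    have "\<forall>us vs. linear (\<lambda>x. form \<xi> (us @ x # vs))" by (simp add: linear_form)
    from form_expansion[OF assms(1) this, of us] True show ?thesis
      by (simp add: form_sum scaleR_tensor_series.rep_eq)
  next
    case False
    then show ?thesis using assms(2)
      by (auto simp: tensor_power_def form_sum scaleR_tensor_series.rep_eq form_prod_vec_eq_0
          intro!: sum.neutral[symmetric])
  qed
qed


section \<open>Rough paths and their signatures\<close>

text \<open>Functionals on \<open>0 \<le> s \<le> t \<le> T\<close> are curried total functions; only their values there matter.\<close>

definition time_simplex :: "real \<Rightarrow> (real \<times> real) set"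
  where "time_simplex T = {(s, t). 0 \<le> s \<and> s \<le> t \<and> t \<le> T}"

definition partitions :: "real \<Rightarrow> real list set"
  where "partitions T = {ts. ts \<noteq> [] \<and> sorted_wrt (<) ts \<and> hd ts = 0 \<and> last ts = T}"

definition total_variation ::
    "real \<Rightarrow> real \<Rightarrow> nat \<Rightarrow> (real \<Rightarrow> real \<Rightarrow> 'v::real_inner tensor_series) \<Rightarrow> ennreal"
  where "total_variation p T N X =
    (\<Sum>k=1..N. SUP ts\<in>partitions T.
       ennreal ((\<Sum>i<length ts - 1. hs_norm k (X (ts ! i) (ts ! Suc i)) powr (p / k)) powr (k / p)))"

definition continuous_in_degree ::
    "nat \<Rightarrow> real \<Rightarrow> (real \<Rightarrow> real \<Rightarrow> 'v::real_inner tensor_series) \<Rightarrow> bool"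
  where "continuous_in_degree n T X \<longleftrightarrow>
    (\<forall>(s, t)\<in>time_simplex T.
       ((\<lambda>(u, v). hs_norm n (X u v - X s t)) \<longlongrightarrow> 0) (at (s, t) within time_simplex T))"

definition rough_path ::
    "real \<Rightarrow> real \<Rightarrow> (real \<Rightarrow> real \<Rightarrow> 'v::real_inner tensor_series) \<Rightarrow> bool"
  where "rough_path p T X \<longleftrightarrow>
    1 \<le> p \<and>
    (\<forall>(s, t)\<in>time_simplex T. X s t \<in> truncated_algebra (nat \<lfloor>p\<rfloor>) \<and> form (X s t) [] = 1) \<and>
    (\<forall>n\<le>nat \<lfloor>p\<rfloor>. continuous_in_degree n T X) \<and>
    (\<forall>s t u. 0 \<le> s \<and> s \<le> t \<and> t \<le> u \<and> u \<le> T \<longrightarrow> X s u = trunc (nat \<lfloor>p\<rfloor>) (X s t * X t u)) \<and>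
    total_variation p T (nat \<lfloor>p\<rfloor>) X < \<infinity>"

text \<open>As usual, continuity is part of the definition of a multiplicative functional. Uniqueness in
  Lyons' theorem fails without it: an additive jump function has finite \<open>q\<close>-variation for all \<open>q > 0\<close>.\<close>

definition lyons_extension ::
    "real \<Rightarrow> real \<Rightarrow> (real \<Rightarrow> real \<Rightarrow> 'v::real_inner tensor_series)
      \<Rightarrow> (real \<Rightarrow> real \<Rightarrow> 'v tensor_series) \<Rightarrow> bool"
  where "lyons_extension p T X Y \<longleftrightarrow>
    rough_path p T X \<and>
    (\<forall>(s, t)\<in>time_simplex T. trunc (nat \<lfloor>p\<rfloor>) (Y s t) = X s t) \<and>
    (\<forall>n. continuous_in_degree n T Y) \<and>
    (\<forall>s t u. 0 \<le> s \<and> s \<le> t \<and> t \<le> u \<and> u \<le> T \<longrightarrow> Y s u = Y s t * Y t u) \<and>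
    (\<forall>N. total_variation p T N Y < \<infinity>)"

text \<open>The extension is unique only on the simplex, hence the description of its value at \<open>(0, T)\<close>.\<close>

definition signature ::
    "real \<Rightarrow> real \<Rightarrow> (real \<Rightarrow> real \<Rightarrow> 'v::real_inner tensor_series) \<Rightarrow> 'v tensor_series"
  where "signature p T X = (THE S. \<exists>Y. lyons_extension p T X Y \<and> S = Y 0 T)"

definition truncated_inverse :: "nat \<Rightarrow> 'v::real_inner tensor_series \<Rightarrow> 'v tensor_series"
  where "truncated_inverse n \<xi> =
    (THE \<eta>. \<eta> \<in> truncated_algebra n \<and> trunc n (\<xi> * \<eta>) = 1 \<and> trunc n (\<eta> * \<xi>) = 1)"

text \<open>The functional identified with a path.\<close>

definition path_increments ::
    "nat \<Rightarrow> (real \<Rightarrow> 'v::real_inner tensor_series) \<Rightarrow> real \<Rightarrow> real \<Rightarrow> 'v tensor_series"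
  where "path_increments n x s t = trunc n (truncated_inverse n (x s) * x t)"

definition signature_tail ::
    "real \<Rightarrow> real \<Rightarrow> (real \<Rightarrow> real \<Rightarrow> 'v::real_inner tensor_series) \<Rightarrow> ereal"
  where "signature_tail p T X =
    limsup (\<lambda>n. ereal ((Gamma (n / p + 1) * hs_norm n (signature p T X)) powr (p / n)))"

end

theory Submission
  imports Defs "HOL-Real_Asymp.Real_Asymp" "Jordan_Normal_Form.Char_Poly"
begin

text \<open>
  Write \<open>S = exp (l\<^sub>a + l\<^sub>b)\<close> and let \<open>S\<^sub>n\<close> be its component of degree \<open>n\<close>. The signature is \<open>S\<close>:
  the functional \<open>exp ((t - s) (l\<^sub>a + l\<^sub>b))\<close> is multiplicative, and its component of degree \<open>k\<close> is
  \<open>O((t - s)\<^bsup>k/b\<^esup>)\<close>, since a product of fewer than \<open>k/b\<close> factors of degree at most \<open>b\<close> does not reach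
  degree \<open>k\<close>; so it is a Lyons extension of the path, and there is only one (\<open>signature_exp\<close>). What is
  left is the growth of \<open>\<parallel>S\<^sub>n\<parallel>\<close>, and it is read off the behaviour of \<open>F r = (\<Sum>n. r\<^sup>n \<parallel>S\<^sub>n\<parallel>)\<close> for large \<open>r\<close>.

  Upper bound. Submultiplicativity of the norm gives
  \<open>F r \<le> exp (r\<^sup>a \<parallel>l\<^sub>a\<parallel> + r\<^sup>b \<parallel>l\<^sub>b\<parallel>)\<close>. As \<open>a < b\<close>, the first summand is negligible, and integrating the bound
  for \<open>r\<^sup>n \<parallel>S\<^sub>n\<parallel>\<close> against \<open>exp (- t)\<close> with \<open>t = \<beta> r\<^sup>b\<close> turns the left-hand side into a Gamma function:
  \<open>\<Gamma>(n/b + 1) \<parallel>S\<^sub>n\<parallel> \<le> K \<beta>\<^bsup>n/b\<^esup>\<close> for every \<open>\<beta> > \<parallel>l\<^sub>b\<parallel>\<close> (\<open>Gamma_bound_of_exp_bound\<close>).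

  Lower bound. If such an estimate held for some \<open>\<beta>\<close> with \<open>0 < \<beta> < \<parallel>l\<^sub>b\<parallel>\<close>, then \<open>F r\<close> would be
  \<open>O((1 + \<beta> r\<^sup>b) exp (\<beta> r\<^sup>b))\<close> (\<open>power_sum_le_of_Gamma_bound\<close>). This is refuted by a finite-dimensional
  representation of the tensor algebra. Its space consists of functionals on words that are determined by
  their values on words shorter than \<open>b\<close>: a further block of \<open>b\<close> letters multiplies the value by the
  coefficient of \<open>l\<^sub>b / \<parallel>l\<^sub>b\<parallel>\<close> at that block. There \<open>l\<^sub>b\<close> has the eigenvalue \<open>\<parallel>l\<^sub>b\<parallel>\<close>, with an eigenvector
  supported at the empty word, and pairing a tensor of degree \<open>n\<close> with such a functional costs at most its
  norm times a constant that does not depend on \<open>n\<close>. After scaling degree \<open>n\<close> by \<open>r\<^sup>n\<close>, the element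
  \<open>l\<^sub>a + l\<^sub>b\<close> acts as \<open>r\<^sup>b (l\<^sub>b + r\<^bsup>a-b\<^esup> l\<^sub>a)\<close>, a small perturbation of \<open>r\<^sup>b l\<^sub>b\<close>. Eigenvalues depend
  continuously on the matrix (\<open>eigenvalue_perturbation\<close>), so it has an eigenvalue \<open>r\<^sup>b z\<close> with \<open>z\<close> close to
  \<open>\<parallel>l\<^sub>b\<parallel>\<close>. Then \<open>exp (r\<^sup>b z)\<close> is an eigenvalue of the scaled \<open>S\<close>, and therefore
  \<open>exp (r\<^sup>b (\<parallel>l\<^sub>b\<parallel> - \<epsilon>)) \<le> D F r\<close> for large \<open>r\<close> (\<open>exp_degree_sum_lower_bound\<close>). As \<open>r\<close> grows, this contradicts
  the previous estimate.
\<close>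

unbundle no vec_syntax

section \<open>Perturbation of eigenvalues\<close>

text \<open>
  Makes the spectral theory of matrices, which are indexed by numbers, available for kernels on any finite set.
\<close>

lemma eigenvalue_of_kernel_matrix:
  fixes K :: "'i \<Rightarrow> 'i \<Rightarrow> complex"
  assumes h: "bij_betw h {0..<n} I"
  shows "eigenvalue (mat n n (\<lambda>(i, j). K (h i) (h j))) z \<longleftrightarrow>
    (\<exists>y. (\<exists>i\<in>I. y i \<noteq> 0) \<and> (\<forall>i\<in>I. (\<Sum>j\<in>I. K i j * y j) = z * y i))"
proof
  let ?M = "mat n n (\<lambda>(i, j). K (h i) (h j))"
  have img: "h ` {0..<n} = I" and inj: "inj_on h {0..<n}"
    using h by (auto simp: bij_betw_def)
  have app: "(?M *\<^sub>v v) $ i = (\<Sum>j=0..<n. K (h i) (h j) * v $ j)"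
    if "v \<in> carrier_vec n" "i < n" for v i
    using that by (simp add: scalar_prod_def)
  show "\<exists>y. (\<exists>i\<in>I. y i \<noteq> 0) \<and> (\<forall>i\<in>I. (\<Sum>j\<in>I. K i j * y j) = z * y i)"
    if "eigenvalue ?M z"
  proof -
    from that obtain v where v: "v \<in> carrier_vec n" "v \<noteq> 0\<^sub>v n" "?M *\<^sub>v v = z \<cdot>\<^sub>v v"
      by (auto simp: eigenvalue_def eigenvector_def)
    define y where "y i = v $ (inv_into {0..<n} h i)" for i
    have yh: "y (h i) = v $ i" if "i < n" for i
      using that inj by (simp add: y_def)
    obtain i where "i < n" "v $ i \<noteq> 0"
      using v by (metis carrier_vecD eq_vecI index_zero_vec)
    then have "\<exists>i\<in>I. y i \<noteq> 0" using yh img by force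
    moreover have "(\<Sum>j\<in>I. K i j * y j) = z * y i" if "i \<in> I" for i
    proof -
      from that img obtain k where k: "k < n" "i = h k" by force
      have "(\<Sum>j\<in>I. K i j * y j) = (\<Sum>j=0..<n. K (h k) (h j) * v $ j)"
        unfolding k(2) by (subst sum.reindex_bij_betw[OF h, symmetric]) (simp add: yh)
      also have "\<dots> = (z \<cdot>\<^sub>v v) $ k" using app[OF v(1) k(1)] v(3) by simp
      also have "\<dots> = z * y i" using k v(1) yh by simp
      finally show ?thesis .
    qed
    ultimately show ?thesis by blast
  qed
  show "eigenvalue ?M z"
    if "\<exists>y. (\<exists>i\<in>I. y i \<noteq> 0) \<and> (\<forall>i\<in>I. (\<Sum>j\<in>I. K i j * y j) = z * y i)"
  proof -
    from that obtain y i where y: "i \<in> I" "y i \<noteq> 0"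
      "\<And>i. i \<in> I \<Longrightarrow> (\<Sum>j\<in>I. K i j * y j) = z * y i" by blast
    define v where "v = Matrix.vec n (\<lambda>i. y (h i))"
    have v: "v \<in> carrier_vec n" by (simp add: v_def)
    from y(1) img obtain k where k: "k < n" "i = h k" by force
    have "v \<noteq> 0\<^sub>v n"
    proof
      assume "v = 0\<^sub>v n"
      then have "v $ k = 0" using k by simp
      then show False using k y by (simp add: v_def)
    qed
    moreover have "?M *\<^sub>v v = z \<cdot>\<^sub>v v"
    proof (rule eq_vecI)
      fix k assume "k < dim_vec (z \<cdot>\<^sub>v v)"
      then have k: "k < n" by (simp add: v_def)
      then have "h k \<in> I" using img by force
      have "(?M *\<^sub>v v) $ k = (\<Sum>j=0..<n. K (h k) (h j) * y (h j))"
        using app[OF v k] by (simp add: v_def)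
      also have "\<dots> = (\<Sum>j\<in>I. K (h k) j * y j)"
        by (rule sum.reindex_bij_betw[OF h])
      also have "\<dots> = (z \<cdot>\<^sub>v v) $ k" using y(3)[OF \<open>h k \<in> I\<close>] k by (simp add: v_def)
      finally show "(?M *\<^sub>v v) $ k = (z \<cdot>\<^sub>v v) $ k" .
    qed (simp add: v_def)
    ultimately show ?thesis using v by (auto simp: eigenvalue_def eigenvector_def)
  qed
qed

text \<open>
  The characteristic polynomial at \<open>z\<^sub>0\<close> is the product of the differences between \<open>z\<^sub>0\<close> and the eigenvalues.
  It is a continuous function of \<open>t\<close>, being a determinant, and it vanishes at \<open>t = 0\<close>; a small product of
  \<open>card I\<close> factors has a small factor.
\<close>

lemma eigenvalue_perturbation:
  fixes A B :: "'i \<Rightarrow> 'i \<Rightarrow> complex"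
  assumes fin: "finite I" and "i\<^sub>0 \<in> I" "y\<^sub>0 i\<^sub>0 \<noteq> 0"
    and eig: "\<And>i. i \<in> I \<Longrightarrow> (\<Sum>j\<in>I. A i j * y\<^sub>0 j) = z\<^sub>0 * y\<^sub>0 i"
    and "\<epsilon> > 0"
  shows "\<forall>\<^sub>F t in at_right (0::real). \<exists>z y. norm (z - z\<^sub>0) < \<epsilon> \<and> (\<exists>i\<in>I. y i \<noteq> 0) \<and>
    (\<forall>i\<in>I. (\<Sum>j\<in>I. (A i j + of_real t * B i j) * y j) = z * y i)"
proof -
  obtain h where h: "bij_betw h {0..<card I} I"
    using ex_bij_betw_nat_finite[OF fin] by blast
  define n where "n = card I"
  note h = h[folded n_def]
  define M where "M t = mat n n (\<lambda>(i, j). A (h i) (h j) + of_real t * B (h i) (h j))" for t :: real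
  have M: "M t \<in> carrier_mat n n" for t by (simp add: M_def)
  define q where "q t = poly (char_poly (M t)) z\<^sub>0" for t
  have q: "q t = (\<Sum>p | p permutes {0..<n}. signof p *
      (\<Prod>i=0..<n. - (A (h i) (h (p i)) + of_real t * B (h i) (h (p i)) - (if i = p i then z\<^sub>0 else 0))))" for t
  proof -
    have C: "- char_matrix (M t) z\<^sub>0 \<in> carrier_mat n n" using M by simp
    show ?thesis unfolding q_def char_poly_matrix[OF M] det_def'[OF C]
      by (intro sum.cong prod.cong arg_cong2[where f = "(*)"] refl)
         (auto simp: char_matrix_def M_def permutes_in_image)
  qed
  have lim: "(q \<longlongrightarrow> q 0) (at_right 0)"
    unfolding q by (intro tendsto_intros) 
  have ev0: "eigenvalue (M 0) z\<^sub>0"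
    unfolding M_def using eigenvalue_of_kernel_matrix[OF h, of "\<lambda>i j. A i j + of_real 0 * B i j"] assms(2,3) eig
    by auto
  then have "q 0 = 0"
    using eigenvalue_root_char_poly[OF M] by (simp add: q_def)
  with lim have "(q \<longlongrightarrow> 0) (at_right 0)" by simp
  then have "\<forall>\<^sub>F t in at_right 0. norm (q t) < \<epsilon> ^ n"
    using \<open>\<epsilon> > 0\<close> by (auto dest!: tendstoD[where e = "\<epsilon> ^ n"])
  then show ?thesis
  proof eventually_elim
    case (elim t)
    obtain zs where zs: "char_poly (M t) = (\<Prod>z\<leftarrow>zs. [:- z, 1:])" "length zs = n"
      using char_poly_factorized[OF M] by blast
    have "\<exists>z\<in>set zs. norm (z - z\<^sub>0) < \<epsilon>"
    proof (rule ccontr)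
      assume "\<not> ?thesis"
      then have "\<forall>z\<in>set zs. \<epsilon> \<le> norm (z - z\<^sub>0)" by auto
      then have "\<epsilon> ^ length zs \<le> norm (poly (\<Prod>z\<leftarrow>zs. [:- z, 1:]) z\<^sub>0)"
      proof (induction zs)
        case (Cons z zs)
        have "\<epsilon> * \<epsilon> ^ length zs \<le> norm (z\<^sub>0 - z) * norm (poly (\<Prod>z\<leftarrow>zs. [:- z, 1:]) z\<^sub>0)"
          using Cons \<open>\<epsilon> > 0\<close> by (intro mult_mono) (auto simp: norm_minus_commute)
        then show ?case by (simp flip: left_diff_distrib norm_mult)
      qed simp
      then show False using elim by (simp add: q_def zs)
    qed
    then obtain z where z: "z \<in> set zs" "norm (z - z\<^sub>0) < \<epsilon>" by blast
    have "poly (char_poly (M t)) z = 0"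
      using z(1) by (simp add: zs(1) poly_prod_list prod_list_zero_iff image_iff)
    then have "eigenvalue (M t) z" using eigenvalue_root_char_poly[OF M] by simp
    then have "\<exists>y. (\<exists>i\<in>I. y i \<noteq> 0) \<and> (\<forall>i\<in>I. (\<Sum>j\<in>I. (A i j + of_real t * B i j) * y j) = z * y i)"
      using eigenvalue_of_kernel_matrix[OF h, of "\<lambda>i j. A i j + of_real t * B i j"] by (simp add: M_def)
    with z(2) show ?case by blast
  qed
qed

section \<open>The Hilbert--Schmidt norm and the grading\<close>

abbreviation words :: "'v set \<Rightarrow> nat \<Rightarrow> 'v list set"
  where "words E n \<equiv> {ws. set ws \<subseteq> E \<and> length ws = n}"

lemma L2_set_sum_le: "L2_set (\<lambda>i. \<Sum>k\<in>K. f k i) A \<le> (\<Sum>k\<in>K. L2_set (f k) A)"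
proof (induction K rule: infinite_finite_induct)
  case (insert k K)
  then have "L2_set (\<lambda>i. f k i + (\<Sum>k\<in>K. f k i)) A \<le> L2_set (f k) A + (\<Sum>k\<in>K. L2_set (f k) A)"
    by (intro order_trans[OF L2_set_triangle_ineq] add_left_mono)
  with insert show ?case by simp
qed (simp_all add: L2_set_0')

lemma hs_norm_some_basis: "hs_norm n \<xi> = L2_set (form \<xi>) (words (SOME B. orthonormal_basis B) n)"
  by (simp add: hs_norm_def hs_inner_def L2_set_def power2_eq_square)

lemma hs_norm_nonneg [simp]: "0 \<le> hs_norm n \<xi>"
  by (simp add: hs_norm_some_basis)

lemma hs_norm_sum_le: "hs_norm n (\<Sum>i\<in>A. \<xi> i) \<le> (\<Sum>i\<in>A. hs_norm n (\<xi> i))"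
proof -
  have "form (\<Sum>i\<in>A. \<xi> i) = (\<lambda>ws. \<Sum>i\<in>A. form (\<xi> i) ws)"
    by (rule ext) (rule form_sum)
  then show ?thesis
    unfolding hs_norm_some_basis using L2_set_sum_le[of "\<lambda>i. form (\<xi> i)"] by simp
qed

lemma hs_norm_add_le: "hs_norm n (\<xi> + \<eta>) \<le> hs_norm n \<xi> + hs_norm n \<eta>"
  unfolding hs_norm_some_basis using L2_set_triangle_ineq by (simp add: form_simps)

lemma hs_norm_scaleR: "hs_norm n (c *\<^sub>R \<xi>) = \<bar>c\<bar> * hs_norm n \<xi>"
  by (simp add: hs_norm_some_basis form_simps L2_set_def power_mult_distrib real_sqrt_mult
      flip: sum_distrib_left)

lemma hs_norm_cong: "(\<And>ws. length ws = n \<Longrightarrow> form \<xi> ws = form \<eta> ws) \<Longrightarrow> hs_norm n \<xi> = hs_norm n \<eta>"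
  unfolding hs_norm_some_basis by (intro L2_set_cong) auto

lemma hs_norm_zero [simp]: "hs_norm n 0 = 0"
  using hs_norm_scaleR[of n 0 0] by simp

lemma hs_norm_diff_le: "hs_norm n (\<xi> - \<eta>) \<le> hs_norm n \<xi> + hs_norm n \<eta>"
  using hs_norm_add_le[of n \<xi> "- \<eta>"] hs_norm_scaleR[of n "-1" \<eta>] by simp

lemma tensor_power_degree: "\<xi> \<in> tensor_power n \<Longrightarrow> length ws \<noteq> n \<Longrightarrow> form \<xi> ws = 0"
  by (auto simp: tensor_power_def)

lemma hs_norm_tensor_power: "\<xi> \<in> tensor_power k \<Longrightarrow> n \<noteq> k \<Longrightarrow> hs_norm n \<xi> = 0"
  using hs_norm_cong[of n \<xi> 0] by (simp add: tensor_power_degree form_simps)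

lemma tensor_power_mult:
  assumes "\<xi> \<in> tensor_power m" "\<eta> \<in> tensor_power n"
  shows "\<xi> * \<eta> \<in> tensor_power (m + n)"
proof -
  have "form \<xi> (take k ws) * form \<eta> (drop k ws) = 0" if "length ws \<noteq> m + n" "k \<le> length ws" for k ws
    using that assms tensor_power_degree[of \<xi> m "take k ws"] tensor_power_degree[of \<eta> n "drop k ws"] by fastforce
  then show ?thesis by (auto simp: tensor_power_def form_simps intro!: sum.neutral)
qed

lemma one_in_tensor_power: "1 \<in> tensor_power 0"
  by (simp add: tensor_power_def form_simps)

lemma tensor_power_power: "\<xi> \<in> tensor_power n \<Longrightarrow> \<xi> ^ q \<in> tensor_power (q * n)"
  by (induction q) (auto intro: one_in_tensor_power tensor_power_mult)

lemma subspace_tensor_power: "subspace (tensor_power n)"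
  by (auto simp: subspace_def tensor_power_def form_simps)

lemma tensor_vec_in_tensor_power: "tensor_vec v \<in> tensor_power 1"
  by (auto simp: tensor_power_def tensor_vec.rep_eq split: list.split)

lemma homogeneous_lie_subset_tensor_power: "homogeneous_lie n \<subseteq> tensor_power n"
proof (induction n rule: induct_nat_012)
  case 0
  show ?case using subspace_0[OF subspace_tensor_power] by auto
next
  case 1
  show ?case using tensor_vec_in_tensor_power by auto
next
  case (ge2 n)
  have "bracket (tensor_vec v) l \<in> tensor_power (Suc (Suc n))" if "l \<in> homogeneous_lie (Suc n)" for v and l :: "'a tensor_series"
    unfolding bracket_def using that ge2
      tensor_power_mult[OF tensor_vec_in_tensor_power[of v], of l "Suc n"]
      tensor_power_mult[OF _ tensor_vec_in_tensor_power[of v], of l "Suc n"]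
    by (intro subspace_diff[OF subspace_tensor_power]) auto
  then show ?case
    unfolding homogeneous_lie.simps
    by (intro span_minimal subspace_tensor_power) auto
qed

section \<open>The exponential series\<close>

text \<open>
  A series without constant term raises the degree by at least one with each factor. So in a fixed degree the
  exponential is a finite sum, and its identities become polynomial ones.
\<close>

lemma form_power_eq_0:
  assumes "form \<xi> [] = 0" "length ws < k"
  shows "form (\<xi> ^ k) ws = 0"
  using assms(2)
proof (induction k arbitrary: ws)
  case (Suc k)
  have "form \<xi> (take j ws) * form (\<xi> ^ k) (drop j ws) = 0" if "j \<le> length ws" for j
    using that Suc assms(1) by (cases "j = 0") auto
  then show ?case by (auto simp: form_simps intro!: sum.neutral)
qed simp

lemma power_scaleR:
  fixes x :: "'a::real_algebra_1"
  shows "(c *\<^sub>R x) ^ n = c ^ n *\<^sub>R x ^ n"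
  by (induction n) (simp_all add: mult.commute)

lemma form_tensor_exp_finite:
  assumes "form \<xi> [] = 0" "length ws \<le> K"
  shows "form (tensor_exp (t *\<^sub>R \<xi>)) ws = (\<Sum>k\<le>K. t ^ k / fact k * form (\<xi> ^ k) ws)"
proof -
  have "(\<Sum>k. form ((t *\<^sub>R \<xi>) ^ k) ws / fact k) = (\<Sum>k\<le>K. form ((t *\<^sub>R \<xi>) ^ k) ws / fact k)"
    using assms by (intro suminf_finite) (auto simp: form_simps form_power_eq_0)
  then show ?thesis by (simp add: form_tensor_exp power_scaleR form_simps)
qed

lemma tensor_exp_add:
  assumes "form \<xi> [] = 0"
  shows "tensor_exp (s *\<^sub>R \<xi>) * tensor_exp (t *\<^sub>R \<xi>) = tensor_exp ((s + t) *\<^sub>R \<xi>)"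
proof (rule tensor_series_eqI)
  fix ws :: "'a list"
  define n where "n = length ws"
  define c where "c r k = (s ^ k / fact k) * (t ^ (r - k) / fact (r - k))" for r k :: nat
  have binom: "(\<Sum>k\<le>r. c r k) = (s + t) ^ r / fact r" for r
    unfolding binomial_ring sum_divide_distrib c_def
    by (intro sum.cong refl) (simp add: binomial_fact field_simps)
  have "form (tensor_exp (s *\<^sub>R \<xi>) * tensor_exp (t *\<^sub>R \<xi>)) ws =
     (\<Sum>j\<le>n. (\<Sum>k\<le>n. s ^ k / fact k * form (\<xi> ^ k) (take j ws)) *
        (\<Sum>l\<le>n. t ^ l / fact l * form (\<xi> ^ l) (drop j ws)))"
    by (simp add: form_simps form_tensor_exp_finite[OF assms, where K = n] n_def)
  also have "\<dots> = (\<Sum>j\<le>n. \<Sum>k\<le>n. \<Sum>l\<le>n. (s ^ k / fact k * (t ^ l / fact l)) *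
       (form (\<xi> ^ k) (take j ws) * form (\<xi> ^ l) (drop j ws)))"
    by (simp add: sum_product mult_ac)
  also have "\<dots> = (\<Sum>k\<le>n. \<Sum>j\<le>n. \<Sum>l\<le>n. (s ^ k / fact k * (t ^ l / fact l)) *
       (form (\<xi> ^ k) (take j ws) * form (\<xi> ^ l) (drop j ws)))"
    by (rule sum.swap)
  also have "\<dots> = (\<Sum>k\<le>n. \<Sum>l\<le>n. \<Sum>j\<le>n. (s ^ k / fact k * (t ^ l / fact l)) *
       (form (\<xi> ^ k) (take j ws) * form (\<xi> ^ l) (drop j ws)))"
    by (intro sum.cong refl sum.swap)
  also have "\<dots> = (\<Sum>k\<le>n. \<Sum>l\<le>n. (s ^ k / fact k * (t ^ l / fact l)) * form (\<xi> ^ (k + l)) ws)"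
    by (simp add: power_add form_simps sum_distrib_left n_def)
  also have "\<dots> = (\<Sum>(k, l)\<in>{..n} \<times> {..n}. (s ^ k / fact k * (t ^ l / fact l)) * form (\<xi> ^ (k + l)) ws)"
    by (simp add: sum.cartesian_product)
  also have "\<dots> = (\<Sum>(k, l) | k + l \<le> n. (s ^ k / fact k * (t ^ l / fact l)) * form (\<xi> ^ (k + l)) ws)"
    by (rule sum.mono_neutral_right)
       (auto simp: not_le intro!: form_power_eq_0[OF assms] simp: n_def)
  also have "\<dots> = (\<Sum>r\<le>n. \<Sum>k\<le>r. c r k * form (\<xi> ^ r) ws)"
    by (simp add: sum.triangle_reindex_eq c_def)
  also have "\<dots> = form (tensor_exp ((s + t) *\<^sub>R \<xi>)) ws"
    by (simp add: binom form_tensor_exp_finite[OF assms, where K = n] n_def flip: sum_distrib_right)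
  finally show "form (tensor_exp (s *\<^sub>R \<xi>) * tensor_exp (t *\<^sub>R \<xi>)) ws = \<dots>" .
qed

lemma tensor_exp_0: "tensor_exp 0 = 1"
proof (rule tensor_series_eqI)
  fix ws :: "'a list"
  have "form (tensor_exp 0) ws = (\<Sum>k\<le>length ws. 0 ^ k / fact k * form (0 ^ k) ws)"
    using form_tensor_exp_finite[of 0 ws "length ws" 0] by (simp add: form_simps)
  also have "\<dots> = (\<Sum>k\<le>length ws. if k = 0 then form 1 ws else 0)"
    by (intro sum.cong) (auto simp: power_0_left)
  finally show "form (tensor_exp 0) ws = form 1 ws" by simp
qed

section \<open>Norms in coordinates\<close>

context
  fixes E :: "'v::real_inner set"
  assumes E: "orthonormal_basis E"
begin

lemma finite_basis: "finite E"
  using E by (simp add: orthonormal_basis_def)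

lemma finite_words: "finite (words E n)"
  using finite_lists_length_eq[OF finite_basis, of n] by simp

lemma hs_norm_basis: "hs_norm n \<xi> = L2_set (form \<xi>) (words E n)"
  by (simp add: hs_norm_def hs_inner_eq[OF E] L2_set_def power2_eq_square)

lemma form_eq_0_of_basis:
  assumes "\<And>ws. ws \<in> words E n \<Longrightarrow> form \<xi> ws = 0" "length ws = n"
  shows "form \<xi> ws = 0"
proof -
  have "\<forall>us vs. linear (\<lambda>x. form \<xi> (us @ x # vs))" by (simp add: linear_form)
  from form_expansion[OF E this, of ws] show ?thesis using assms by (auto intro!: sum.neutral)
qed

text \<open>
  The Hilbert--Schmidt norm is multiplicative on products of homogeneous tensors, and the component of degree
  \<open>n\<close> of a product is a sum of such products.
\<close>

lemma hs_norm_mult_le: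
  fixes \<xi> \<eta> :: "'v tensor_series"
  shows "hs_norm n (\<xi> * \<eta>) \<le> (\<Sum>k\<le>n. hs_norm k \<xi> * hs_norm (n - k) \<eta>)"
proof -
  have "hs_norm n (\<xi> * \<eta>) = L2_set (\<lambda>ws. \<Sum>k\<le>n. form \<xi> (take k ws) * form \<eta> (drop k ws)) (words E n)"
    unfolding hs_norm_basis by (intro L2_set_cong) (auto simp: form_simps)
  also have "\<dots> \<le> (\<Sum>k\<le>n. L2_set (\<lambda>ws. form \<xi> (take k ws) * form \<eta> (drop k ws)) (words E n))"
    by (rule L2_set_sum_le)
  also have "\<dots> = (\<Sum>k\<le>n. hs_norm k \<xi> * hs_norm (n - k) \<eta>)"
  proof (intro sum.cong refl)
    fix k assume "k \<in> {..n}"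
    then have "words E n = words E (k + (n - k))" by simp
    then have "(\<Sum>ws\<in>words E n. (form \<xi> (take k ws) * form \<eta> (drop k ws))\<^sup>2) =
      (\<Sum>us\<in>words E k. \<Sum>vs\<in>words E (n - k). (form \<xi> us * form \<eta> vs)\<^sup>2)"
      by (simp only: sum_words_append[OF finite_basis]) (auto intro!: sum.cong)
    then show "L2_set (\<lambda>ws. form \<xi> (take k ws) * form \<eta> (drop k ws)) (words E n)
      = hs_norm k \<xi> * hs_norm (n - k) \<eta>"
      by (simp add: L2_set_def hs_norm_basis sum_product power_mult_distrib flip: real_sqrt_mult)
  qed
  finally show ?thesis .
qed

text \<open>
  The weighted sums \<open>\<Sum>n. r\<^sup>n \<parallel>\<xi>\<^sub>n\<parallel>\<close> behave like a norm on a Banach algebra. Partial sums are used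
  throughout, so that convergence need not be discussed.
\<close>

lemma degree_sum_mult_le:
  fixes \<xi> \<eta> :: "'v tensor_series"
  assumes "0 \<le> r"
  shows "(\<Sum>n\<le>L. r ^ n * hs_norm n (\<xi> * \<eta>)) \<le>
    (\<Sum>n\<le>L. r ^ n * hs_norm n \<xi>) * (\<Sum>n\<le>L. r ^ n * hs_norm n \<eta>)"
proof -
  let ?f = "\<lambda>k l. (r ^ k * hs_norm k \<xi>) * (r ^ l * hs_norm l \<eta>)"
  have "(\<Sum>n\<le>L. r ^ n * hs_norm n (\<xi> * \<eta>)) \<le> (\<Sum>n\<le>L. \<Sum>k\<le>n. ?f k (n - k))"
  proof (intro sum_mono)
    fix n
    have "r ^ n * hs_norm n (\<xi> * \<eta>) \<le> r ^ n * (\<Sum>k\<le>n. hs_norm k \<xi> * hs_norm (n - k) \<eta>)"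
      using assms by (intro mult_left_mono hs_norm_mult_le) auto
    also have "\<dots> = (\<Sum>k\<le>n. ?f k (n - k))"
      unfolding sum_distrib_left
      by (intro sum.cong refl) (simp add: mult_ac flip: power_add)
    finally show "r ^ n * hs_norm n (\<xi> * \<eta>) \<le> (\<Sum>k\<le>n. ?f k (n - k))" .
  qed
  also have "\<dots> = (\<Sum>(k, l) | k + l \<le> L. ?f k l)"
    by (rule sum.triangle_reindex_eq[symmetric])
  also have "\<dots> \<le> (\<Sum>(k, l)\<in>{..L} \<times> {..L}. ?f k l)"
    using assms by (intro sum_mono2) auto
  also have "\<dots> = (\<Sum>n\<le>L. r ^ n * hs_norm n \<xi>) * (\<Sum>n\<le>L. r ^ n * hs_norm n \<eta>)"
    by (simp add: sum_product sum.cartesian_product)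
  finally show ?thesis .
qed

lemma degree_sum_power_le:
  fixes \<xi> :: "'v tensor_series"
  assumes "0 \<le> r" and c: "\<And>L. (\<Sum>n\<le>L. r ^ n * hs_norm n \<xi>) \<le> c"
  shows "(\<Sum>n\<le>L. r ^ n * hs_norm n (\<xi> ^ k)) \<le> c ^ k"
proof (induction k)
  case 0
  have one: "hs_norm n (1 :: 'v tensor_series) = (if n = 0 then 1 else 0)" for n
  proof (cases "n = 0")
    case True
    have "words E 0 = {[]}" by auto
    then show ?thesis using True by (simp add: hs_norm_basis form_simps L2_set_def)
  qed (simp add: hs_norm_tensor_power[OF one_in_tensor_power])
  show ?case by (simp add: one if_distrib cong: if_cong)
next
  case (Suc k)
  have "0 \<le> c" using c[of 0] hs_norm_nonneg[of 0 \<xi>] by (simp del: hs_norm_nonneg)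
  have "(\<Sum>n\<le>L. r ^ n * hs_norm n (\<xi> ^ Suc k)) \<le>
    (\<Sum>n\<le>L. r ^ n * hs_norm n \<xi>) * (\<Sum>n\<le>L. r ^ n * hs_norm n (\<xi> ^ k))"
    using degree_sum_mult_le[OF assms(1)] by simp
  also have "\<dots> \<le> c * c ^ k"
    using assms Suc \<open>0 \<le> c\<close> by (intro mult_mono sum_nonneg) auto
  finally show ?case by simp
qed

lemma degree_sum_exp_le:
  fixes \<xi> :: "'v tensor_series"
  assumes "0 \<le> r" and c: "\<And>L. (\<Sum>n\<le>L. r ^ n * hs_norm n \<xi>) \<le> c" and "form \<xi> [] = 0"
  shows "(\<Sum>n\<le>L. r ^ n * hs_norm n (tensor_exp \<xi>)) \<le> exp c"
proof -
  have "0 \<le> c" using c[of 0] hs_norm_nonneg[of 0 \<xi>] by (simp del: hs_norm_nonneg)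
  have "(\<Sum>n\<le>L. r ^ n * hs_norm n (tensor_exp \<xi>)) \<le> (\<Sum>n\<le>L. r ^ n * (\<Sum>k\<le>L. hs_norm n (\<xi> ^ k) / fact k))"
  proof (intro sum_mono mult_left_mono)
    fix n assume "n \<in> {..L}"
    then have "hs_norm n (tensor_exp \<xi>) = hs_norm n (\<Sum>k\<le>L. (1 / fact k) *\<^sub>R \<xi> ^ k)"
      using form_tensor_exp_finite[OF assms(3), where t = 1 and K = L]
      by (intro hs_norm_cong) (simp add: form_sum form_simps)
    also have "\<dots> \<le> (\<Sum>k\<le>L. hs_norm n (\<xi> ^ k) / fact k)"
      by (rule order_trans[OF hs_norm_sum_le]) (simp add: hs_norm_scaleR)
    finally show "hs_norm n (tensor_exp \<xi>) \<le> \<dots>" .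
  qed (use assms in auto)
  also have "\<dots> = (\<Sum>k\<le>L. (\<Sum>n\<le>L. r ^ n * hs_norm n (\<xi> ^ k)) / fact k)"
    unfolding sum_distrib_left sum_divide_distrib by (subst sum.swap) simp
  also have "\<dots> \<le> (\<Sum>k\<le>L. c ^ k /\<^sub>R fact k)"
    using degree_sum_power_le[OF assms(1) c]
    by (intro sum_mono) (simp add: divide_right_mono field_simps)
  also have "\<dots> \<le> exp c"
    using summable_exp_generic[of c] \<open>0 \<le> c\<close> unfolding exp_def by (intro sum_le_suminf) auto
  finally show ?thesis .
qed

end

section \<open>Eigenfunctionals of the tensor algebra\<close>

text \<open>
  The counterpart of \<open>form_power_eq_0\<close> for degrees bounded from above.
\<close>

lemma form_power_degree_gt:
  assumes "\<And>ws. b < length ws \<Longrightarrow> form \<xi> ws = 0" and "k * b < length ws"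
  shows "form (\<xi> ^ k) ws = 0"
  using assms(2)
proof (induction k arbitrary: ws)
  case 0
  then show ?case by (auto simp: form_simps)
next
  case (Suc k)
  have "form \<xi> (take j ws) * form (\<xi> ^ k) (drop j ws) = 0" if "j \<le> length ws" for j
    using that Suc assms(1) by (cases "b < j") auto
  then show ?case by (auto simp: form_simps intro!: sum.neutral)
qed

lemma degree_sum_two_homogeneous_le:
  assumes "\<xi> \<in> tensor_power a" "\<eta> \<in> tensor_power b" "0 \<le> r"
  shows "(\<Sum>n\<le>L. r ^ n * hs_norm n (\<xi> + \<eta>)) \<le> r ^ a * hs_norm a \<xi> + r ^ b * hs_norm b \<eta>"
proof -
  have "(\<Sum>n\<le>L. r ^ n * hs_norm n (\<xi> + \<eta>)) \<le> (\<Sum>n\<le>L. r ^ n * (hs_norm n \<xi> + hs_norm n \<eta>))"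
    using assms(3) by (intro sum_mono mult_left_mono hs_norm_add_le) auto
  also have "\<dots> = (\<Sum>n\<le>L. if n = a then r ^ a * hs_norm a \<xi> else 0) + (\<Sum>n\<le>L. if n = b then r ^ b * hs_norm b \<eta> else 0)"
    unfolding sum.distrib[symmetric] using assms(1,2)
    by (intro sum.cong) (auto simp: hs_norm_tensor_power algebra_simps)
  also have "\<dots> \<le> r ^ a * hs_norm a \<xi> + r ^ b * hs_norm b \<eta>"
    using assms(3) by (intro add_mono) (auto simp: sum.delta)
  finally show ?thesis .
qed

text \<open>
  The trailing letters of a word are read in blocks of length \<open>b\<close>, each of which contributes the coefficient of
  \<open>u\<close> at it, and \<open>y\<close> is evaluated at the fewer than \<open>b\<close> letters that remain in front. Only the values of \<open>y\<close> on
  words shorter than \<open>b\<close> matter, so these functionals form a finite-dimensional space. A tensor \<open>\<xi>\<close> acts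
  on a functional \<open>f\<close> by \<open>(\<xi> f) w = (\<Sum>x. form \<xi> x * f (x @ w))\<close>.
\<close>

definition block_functional ::
    "'v::real_inner tensor_series \<Rightarrow> nat \<Rightarrow> ('v list \<Rightarrow> complex) \<Rightarrow> 'v list \<Rightarrow> complex"
  where "block_functional u b y w = y (take (length w mod b) w) *
    of_real (form (u ^ (length w div b)) (drop (length w mod b) w))"

text \<open>
  Appending whole blocks does not change what remains in front. Hence an eigenvalue equation for a block
  functional needs to be checked on words shorter than \<open>b\<close> only.
\<close>

lemma block_functional_append:
  assumes "u \<in> tensor_power b" "0 < b" "length c = q * b"
  shows "block_functional u b y (v @ c) = block_functional u b y v * of_real (form (u ^ q) c)"
proof -
  let ?r = "length v mod b"
  have "length (drop ?r v) = (length v div b) * b"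
    by (simp add: minus_mod_eq_div_mult)
  then have "form (u ^ (length v div b + q)) (drop ?r v @ c) = form (u ^ (length v div b)) (drop ?r v) * form (u ^ q) c"
    unfolding power_add using form_mult_append[OF tensor_power_power[OF assms(1)]] by blast
  moreover have "length (v @ c) mod b = ?r" "length (v @ c) div b = length v div b + q" "?r \<le> length v"
    using assms by simp_all
  ultimately show ?thesis by (simp add: block_functional_def)
qed

context
  fixes E :: "'v::real_inner set"
  assumes E: "orthonormal_basis E"
begin

lemma sum_words_mult:
  fixes f :: "'v list \<Rightarrow> complex"
  shows "(\<Sum>x\<in>words E n. form (\<xi> * \<eta>) x * f x) =
    (\<Sum>i\<le>n. \<Sum>us\<in>words E i. \<Sum>vs\<in>words E (n - i). of_real (form \<xi> us * form \<eta> vs) * f (us @ vs))"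
proof -
  have "(\<Sum>x\<in>words E n. form (\<xi> * \<eta>) x * f x) =
      (\<Sum>x\<in>words E n. \<Sum>i\<le>n. of_real (form \<xi> (take i x) * form \<eta> (drop i x)) * f x)"
    by (intro sum.cong) (auto simp: form_simps sum_distrib_right)
  also have "\<dots> = (\<Sum>i\<le>n. \<Sum>x\<in>words E n. of_real (form \<xi> (take i x) * form \<eta> (drop i x)) * f x)"
    by (rule sum.swap)
  also have "\<dots> = (\<Sum>i\<le>n. \<Sum>us\<in>words E i. \<Sum>vs\<in>words E (n - i). of_real (form \<xi> us * form \<eta> vs) * f (us @ vs))"
  proof (rule sum.cong[OF refl])
    fix i assume "i \<in> {..n}"
    then have "words E n = words E (i + (n - i))" by simp
    then show "(\<Sum>x\<in>words E n. of_real (form \<xi> (take i x) * form \<eta> (drop i x)) * f x) =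
      (\<Sum>us\<in>words E i. \<Sum>vs\<in>words E (n - i). of_real (form \<xi> us * form \<eta> vs) * f (us @ vs))"
      by (simp only: sum_words_append[OF finite_basis[OF E]]) (intro sum.cong; auto)
  qed
  finally show ?thesis .
qed

text \<open>
  Acting with \<open>\<xi> * \<xi>\<^sup>k\<close> amounts to acting with \<open>\<xi>\<close> and then with \<open>\<xi>\<^sup>k\<close>. The degree bounds make all
  sums finite.
\<close>

lemma eigenfunctional_power:
  fixes f :: "'v list \<Rightarrow> complex"
  assumes deg: "\<And>ws. b < length ws \<Longrightarrow> form \<xi> ws = 0"
    and eig: "\<And>w. set w \<subseteq> E \<Longrightarrow> (\<Sum>n\<le>b. \<Sum>x\<in>words E n. form \<xi> x * f (x @ w)) = z * f w"
    and "set w \<subseteq> E"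
  shows "(\<Sum>n\<le>k * b. \<Sum>x\<in>words E n. form (\<xi> ^ k) x * f (x @ w)) = z ^ k * f w"
  using assms(3)
proof (induction k arbitrary: w)
  case 0
  have "words E 0 = {[]}" by auto
  then show ?case by (simp add: form_simps)
next
  case (Suc k)
  define H where "H i j = (\<Sum>us\<in>words E i. \<Sum>vs\<in>words E j. of_real (form \<xi> us * form (\<xi> ^ k) vs) * f (us @ vs @ w))" for i j
  have H0: "H i j = 0" if "b < i \<or> k * b < j" for i j
    using that deg form_power_degree_gt[OF deg, where k = k] by (auto simp: H_def intro!: sum.neutral)
  have "(\<Sum>n\<le>Suc k * b. \<Sum>x\<in>words E n. form (\<xi> ^ Suc k) x * f (x @ w)) =
      (\<Sum>n\<le>Suc k * b. \<Sum>i\<le>n. H i (n - i))"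
    using sum_words_mult[where \<xi> = \<xi> and \<eta> = "\<xi> ^ k" and f = "\<lambda>x. f (x @ w)"] by (simp add: H_def)
  also have "\<dots> = (\<Sum>(i, j) | i + j \<le> Suc k * b. H i j)"
    by (rule sum.triangle_reindex_eq[symmetric])
  also have "\<dots> = (\<Sum>(i, j)\<in>{..b} \<times> {..k * b}. H i j)"
  proof (rule sum.mono_neutral_right)
    show "finite {(i, j). i + j \<le> Suc k * b}"
      by (rule finite_subset[of _ "{..Suc k * b} \<times> {..Suc k * b}"]) auto
  qed (use H0 in \<open>auto simp flip: not_le\<close>)
  also have "\<dots> = (\<Sum>j\<le>k * b. \<Sum>i\<le>b. H i j)"
    by (subst sum.cartesian_product[symmetric]) (rule sum.swap)
  also have "\<dots> = (\<Sum>j\<le>k * b. \<Sum>vs\<in>words E j. form (\<xi> ^ k) vs * (\<Sum>i\<le>b. \<Sum>us\<in>words E i. form \<xi> us * f (us @ vs @ w)))"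
  proof (rule sum.cong[OF refl])
    fix j
    have "(\<Sum>i\<le>b. H i j) = (\<Sum>i\<le>b. \<Sum>vs\<in>words E j. \<Sum>us\<in>words E i. of_real (form \<xi> us * form (\<xi> ^ k) vs) * f (us @ vs @ w))"
      unfolding H_def by (intro sum.cong refl sum.swap)
    also have "\<dots> = (\<Sum>vs\<in>words E j. \<Sum>i\<le>b. \<Sum>us\<in>words E i. of_real (form \<xi> us * form (\<xi> ^ k) vs) * f (us @ vs @ w))"
      by (rule sum.swap)
    finally show "(\<Sum>i\<le>b. H i j) = (\<Sum>vs\<in>words E j. form (\<xi> ^ k) vs * (\<Sum>i\<le>b. \<Sum>us\<in>words E i. form \<xi> us * f (us @ vs @ w)))"
      by (simp add: sum_distrib_left mult_ac)
  qed
  also have "\<dots> = (\<Sum>j\<le>k * b. \<Sum>vs\<in>words E j. form (\<xi> ^ k) vs * (z * f (vs @ w)))"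
    using Suc.prems by (intro sum.cong refl arg_cong2[where f = "(*)"] eig) auto
  also have "\<dots> = z * (\<Sum>j\<le>k * b. \<Sum>vs\<in>words E j. form (\<xi> ^ k) vs * f (vs @ w))"
    by (simp add: sum_distrib_left mult_ac)
  also have "\<dots> = z ^ Suc k * f w"
    using Suc by simp
  finally show ?case .
qed

lemma norm_pairing_le:
  fixes f :: "'v list \<Rightarrow> complex"
  assumes "(\<Sum>x\<in>words E n. (norm (f x))\<^sup>2) \<le> D\<^sup>2" "0 \<le> D"
  shows "norm (\<Sum>x\<in>words E n. form \<xi> x * f x) \<le> hs_norm n \<xi> * D"
proof -
  have "norm (\<Sum>x\<in>words E n. form \<xi> x * f x) \<le> (\<Sum>x\<in>words E n. \<bar>form \<xi> x\<bar> * \<bar>norm (f x)\<bar>)"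
    by (rule order_trans[OF norm_sum]) (simp add: norm_mult)
  also have "\<dots> \<le> hs_norm n \<xi> * L2_set (\<lambda>x. norm (f x)) (words E n)"
    unfolding hs_norm_basis[OF E] by (rule L2_set_mult_ineq)
  also have "\<dots> \<le> hs_norm n \<xi> * D"
    using assms by (intro mult_left_mono) (auto simp: L2_set_def intro: real_le_lsqrt)
  finally show ?thesis .
qed

text \<open>
  An eigenfunctional of \<open>\<xi>\<close> with eigenvalue \<open>z\<close> is one of \<open>exp \<xi>\<close> with eigenvalue \<open>exp z\<close>. The
  Cauchy--Schwarz inequality in each degree bounds the action of \<open>exp \<xi>\<close> by the norms of its components,
  weighted with the growth of the functional.
\<close>

lemma norm_exp_eigenfunctional_le:
  fixes f :: "'v list \<Rightarrow> complex"
  assumes "form \<xi> [] = 0" and deg: "\<And>ws. b < length ws \<Longrightarrow> form \<xi> ws = 0" and "0 < b"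
    and eig: "\<And>w. set w \<subseteq> E \<Longrightarrow> (\<Sum>n\<le>b. \<Sum>x\<in>words E n. form \<xi> x * f (x @ w)) = z * f w"
    and "set w \<subseteq> E" "0 \<le> r" "0 \<le> C"
    and growth: "\<And>n. (\<Sum>x\<in>words E n. (norm (f (x @ w)))\<^sup>2) \<le> (C * r ^ n)\<^sup>2"
    and c: "\<And>L. (\<Sum>n\<le>L. r ^ n * hs_norm n \<xi>) \<le> c"
    and S: "\<And>L. (\<Sum>n\<le>L. r ^ n * hs_norm n (tensor_exp \<xi>)) \<le> S"
  shows "norm (exp z * f w) \<le> C * S"
proof -
  define G where "G k n = (\<Sum>x\<in>words E n. form (\<xi> ^ k) x * f (x @ w))" for k n
  have growth': "norm (\<Sum>x\<in>words E n. form \<eta> x * f (x @ w)) \<le> C * (r ^ n * hs_norm n \<eta>)" for n \<eta>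
    using norm_pairing_le[OF growth, of n \<eta>] \<open>0 \<le> r\<close> \<open>0 \<le> C\<close> by (simp add: mult_ac)
  have "0 \<le> c" using c[of 0] hs_norm_nonneg[of 0 \<xi>] by (simp del: hs_norm_nonneg)
  have G_tail: "norm (\<Sum>n\<le>L. G k n) \<le> C * c ^ k" for k L
  proof -
    have "norm (\<Sum>n\<le>L. G k n) \<le> (\<Sum>n\<le>L. C * (r ^ n * hs_norm n (\<xi> ^ k)))"
      unfolding G_def by (intro order_trans[OF norm_sum] sum_mono growth')
    also have "\<dots> \<le> C * c ^ k"
      unfolding sum_distrib_left[symmetric] using degree_sum_power_le[OF E \<open>0 \<le> r\<close> c] \<open>0 \<le> C\<close>
      by (intro mult_left_mono) auto
    finally show ?thesis .
  qed
  have main: "norm ((\<Sum>k\<le>K. z ^ k /\<^sub>R fact k) * f w) \<le> C * S + C * (exp c - (\<Sum>k\<le>K. c ^ k /\<^sub>R fact k))" for K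
  proof -
    \<comment> \<open>Up to degree \<open>L\<close> the powers up to \<open>K\<close> are complete, but \<open>exp \<xi>\<close> also contains contributions of the powers
      between \<open>K\<close> and \<open>L\<close>; these are bounded by a tail of the series of \<open>exp c\<close>.\<close>
    define L where "L = K * b"
    have "K \<le> L" using \<open>0 < b\<close> by (simp add: L_def)
    have "(\<Sum>n\<le>L. \<Sum>x\<in>words E n. form (tensor_exp \<xi>) x * f (x @ w)) = (\<Sum>n\<le>L. \<Sum>k\<le>L. G k n / fact k)"
    proof (rule sum.cong[OF refl])
      fix n assume "n \<in> {..L}"
      then have "form (tensor_exp \<xi>) x * f (x @ w) = (\<Sum>k\<le>L. form (\<xi> ^ k) x * f (x @ w) / fact k)" if "x \<in> words E n" for x
        using that form_tensor_exp_finite[OF assms(1), of x L 1] by (simp add: sum_distrib_right)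
      then show "(\<Sum>x\<in>words E n. form (tensor_exp \<xi>) x * f (x @ w)) = (\<Sum>k\<le>L. G k n / fact k)"
        unfolding G_def sum_divide_distrib by (subst sum.swap) simp
    qed
    also have "\<dots> = (\<Sum>k\<le>L. (\<Sum>n\<le>L. G k n) / fact k)"
      unfolding sum_divide_distrib by (rule sum.swap)
    also have "\<dots> = (\<Sum>k\<le>K. (\<Sum>n\<le>L. G k n) / fact k) + (\<Sum>k\<in>{K<..L}. (\<Sum>n\<le>L. G k n) / fact k)"
      using \<open>K \<le> L\<close> by (subst sum.union_disjoint[symmetric]) (auto intro: sum.cong)
    also have "(\<Sum>k\<le>K. (\<Sum>n\<le>L. G k n) / fact k) = (\<Sum>k\<le>K. z ^ k /\<^sub>R fact k) * f w"
      unfolding sum_distrib_right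
    proof (rule sum.cong[OF refl])
      fix k assume "k \<in> {..K}"
      then have "k * b \<le> L" by (simp add: L_def)
      moreover have "G k n = 0" if "k * b < n" for n
        using form_power_degree_gt[OF deg, where k = k] that by (auto simp: G_def intro!: sum.neutral)
      ultimately have "(\<Sum>n\<le>L. G k n) = (\<Sum>n\<le>k * b. G k n)"
        by (intro sum.mono_neutral_right) auto
      then show "(\<Sum>n\<le>L. G k n) / fact k = z ^ k /\<^sub>R fact k * f w"
        using eigenfunctional_power[OF deg eig \<open>set w \<subseteq> E\<close>, of k]
        by (simp add: G_def scaleR_conv_of_real field_simps)
    qed
    finally have eq: "(\<Sum>k\<le>K. z ^ k /\<^sub>R fact k) * f w =
        (\<Sum>n\<le>L. \<Sum>x\<in>words E n. form (tensor_exp \<xi>) x * f (x @ w)) - (\<Sum>k\<in>{K<..L}. (\<Sum>n\<le>L. G k n) / fact k)"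
      by simp
    have "norm (\<Sum>n\<le>L. \<Sum>x\<in>words E n. form (tensor_exp \<xi>) x * f (x @ w)) \<le> (\<Sum>n\<le>L. C * (r ^ n * hs_norm n (tensor_exp \<xi>)))"
      by (intro order_trans[OF norm_sum] sum_mono growth')
    also have "\<dots> \<le> C * S"
      unfolding sum_distrib_left[symmetric] using \<open>0 \<le> C\<close> by (intro mult_left_mono S)
    finally have 1: "norm (\<Sum>n\<le>L. \<Sum>x\<in>words E n. form (tensor_exp \<xi>) x * f (x @ w)) \<le> C * S" .
    have "norm (\<Sum>k\<in>{K<..L}. (\<Sum>n\<le>L. G k n) / fact k) \<le> (\<Sum>k\<in>{K<..L}. C * (c ^ k /\<^sub>R fact k))"
      using G_tail by (intro order_trans[OF norm_sum] sum_mono) (simp add: norm_divide field_simps)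
    also have "\<dots> = C * ((\<Sum>k\<le>L. c ^ k /\<^sub>R fact k) - (\<Sum>k\<le>K. c ^ k /\<^sub>R fact k))"
    proof -
      have "{..L} = {..K} \<union> {K<..L}" using \<open>K \<le> L\<close> by auto
      then have "(\<Sum>k\<le>L. c ^ k /\<^sub>R fact k) = (\<Sum>k\<le>K. c ^ k /\<^sub>R fact k) + (\<Sum>k\<in>{K<..L}. c ^ k /\<^sub>R fact k)"
        by (simp only:) (auto intro!: sum.union_disjoint)
      then show ?thesis by (simp add: sum_distrib_left)
    qed
    also have "\<dots> \<le> C * (exp c - (\<Sum>k\<le>K. c ^ k /\<^sub>R fact k))"
      using summable_exp_generic[of c] \<open>0 \<le> c\<close> \<open>0 \<le> C\<close> unfolding exp_def
      by (intro mult_left_mono diff_right_mono sum_le_suminf) auto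
    finally show ?thesis
      unfolding eq by (intro order_trans[OF norm_triangle_ineq4] add_mono 1)
  qed
  have lim: "(\<lambda>K. \<Sum>k\<le>K. x ^ k /\<^sub>R fact k) \<longlonglongrightarrow> exp x" for x :: "'b :: {banach, real_normed_algebra_1}"
    using exp_converges[of x] by (simp add: sums_def_le)
  have "(\<lambda>K. norm ((\<Sum>k\<le>K. z ^ k /\<^sub>R fact k) * f w)) \<longlonglongrightarrow> norm (exp z * f w)"
    by (intro tendsto_intros lim)
  moreover have "(\<lambda>K. C * S + C * (exp c - (\<Sum>k\<le>K. c ^ k /\<^sub>R fact k))) \<longlonglongrightarrow> C * S + C * (exp c - exp c)"
    by (intro tendsto_intros lim)
  ultimately have "norm (exp z * f w) \<le> C * S + C * (exp c - exp c)"
    using main by (intro LIMSEQ_le) auto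
  then show ?thesis by simp
qed

lemma hs_norm_power_unit:
  assumes "u \<in> tensor_power b" "hs_norm b u = 1"
  shows "hs_norm (q * b) ((u :: 'v tensor_series) ^ q) = 1"
proof (induction q)
  case 0
  have "words E 0 = {[]}" by auto
  then show ?case by (simp add: hs_norm_basis[OF E] form_simps L2_set_def)
next
  case (Suc q)
  then show ?case
    using assms(2) hs_inner_mult[OF E assms(1) assms(1), of "q * b" "u ^ q" "u ^ q"]
    by (simp add: hs_norm_def real_sqrt_mult)
qed

text \<open>
  The blocks contribute the norm of a power of \<open>u\<close>, which is one. So block functionals are bounded in square
  mean, uniformly in the degree.
\<close>

lemma sum_block_functional_norm:
  assumes "u \<in> tensor_power b" "hs_norm b u = 1"
  shows "(\<Sum>v\<in>words E n. (norm (block_functional (u :: 'v tensor_series) b y v))\<^sup>2) = (\<Sum>v\<in>words E (n mod b). (norm (y v))\<^sup>2)"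
proof -
  let ?r = "n mod b" and ?q = "n div b"
  have "words E n = words E (?r + ?q * b)" by simp
  then have "(\<Sum>v\<in>words E n. (norm (block_functional u b y v))\<^sup>2) =
    (\<Sum>us\<in>words E ?r. \<Sum>vs\<in>words E (?q * b). (norm (block_functional u b y (us @ vs)))\<^sup>2)"
    by (simp only: sum_words_append[OF finite_basis[OF E]])
  also have "\<dots> = (\<Sum>us\<in>words E ?r. \<Sum>vs\<in>words E (?q * b). (norm (y us))\<^sup>2 * (form (u ^ ?q) vs)\<^sup>2)"
    by (intro sum.cong refl) (auto simp: block_functional_def norm_mult power_mult_distrib)
  also have "\<dots> = (\<Sum>us\<in>words E ?r. (norm (y us))\<^sup>2 * (hs_norm (?q * b) (u ^ ?q))\<^sup>2)"
    unfolding hs_norm_basis[OF E] L2_set_def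
    by (simp add: sum_nonneg flip: sum_distrib_left)
  finally show ?thesis by (simp add: hs_norm_power_unit[OF assms])
qed

end

section \<open>Exponential growth from below\<close>

lemma block_functional_linear:
  assumes "finite I" "take (length v mod b) v \<in> I"
  shows "block_functional u b y v = (\<Sum>j\<in>I. block_functional u b (\<lambda>w. if w = j then 1 else 0) v * y j)"
proof -
  let ?w = "take (length v mod b) v"
  have "(\<Sum>j\<in>I. block_functional u b (\<lambda>w. if w = j then 1 else 0) v * y j) =
    (\<Sum>j\<in>I. if j = ?w then block_functional u b y v else 0)"
    by (intro sum.cong refl) (auto simp: block_functional_def)
  then show ?thesis using assms by simp
qed

context
  fixes E :: "'v::real_inner set"
  assumes E: "orthonormal_basis E"
begin

lemma sum_words_form_sq: "(\<Sum>x\<in>words E n. form \<xi> x * form \<xi> x) = (hs_norm n \<xi>)\<^sup>2"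
  by (simp add: hs_norm_basis[OF E] L2_set_def sum_nonneg power2_eq_square)

text \<open>
  The eigenvector from which the perturbation starts. On the empty word the action of \<open>\<eta>\<close> pairs it with
  \<open>\<eta> / \<parallel>\<eta>\<parallel>\<close>; on a nonempty word \<open>w\<close> shorter than \<open>b\<close> it vanishes, because reading one block of \<open>x @ w\<close>
  leaves a nonempty word.
\<close>

lemma block_functional_empty_word_eigen:
  fixes \<eta> :: "'v tensor_series"
  assumes \<eta>: "\<eta> \<in> tensor_power b" "0 < hs_norm b \<eta>" and "0 < b" and w: "length w < b"
  shows "(\<Sum>x\<in>words E b. form \<eta> x * block_functional (\<eta> /\<^sub>R hs_norm b \<eta>) b (\<lambda>v. if v = [] then 1 else 0) (x @ w))
    = of_real (hs_norm b \<eta>) * (if w = [] then 1 else 0)"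
proof (cases "w = []")
  case True
  have "(\<Sum>x\<in>words E b. form \<eta> x * block_functional (\<eta> /\<^sub>R hs_norm b \<eta>) b (\<lambda>v. if v = [] then 1 else 0) (x @ w))
      = (\<Sum>x\<in>words E b. of_real (form \<eta> x * form \<eta> x / hs_norm b \<eta>))"
    using True \<open>0 < b\<close> by (intro sum.cong) (auto simp: block_functional_def form_simps field_simps)
  also have "\<dots> = of_real ((hs_norm b \<eta>)\<^sup>2 / hs_norm b \<eta>)"
    by (simp only: sum_words_form_sq[symmetric] sum_divide_distrib of_real_sum)
  finally show ?thesis using True by (simp add: power2_eq_square)
next
  case False
  have "block_functional (\<eta> /\<^sub>R hs_norm b \<eta>) b (\<lambda>v. if v = [] then 1 else 0) (x @ w) = 0"
    if "x \<in> words E b" for x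
    using that w False by (auto simp: block_functional_def)
  then show ?thesis using False by simp
qed

lemma sum_degrees_two_homogeneous:
  fixes f :: "'v list \<Rightarrow> complex"
  assumes "\<xi> \<in> tensor_power a" "\<eta> \<in> tensor_power b" "a < b"
  shows "(\<Sum>n\<le>b. \<Sum>x\<in>words E n. form (\<xi> + \<eta>) x * f x)
    = (\<Sum>x\<in>words E a. form \<xi> x * f x) + (\<Sum>x\<in>words E b. form \<eta> x * f x)"
proof -
  have "(\<Sum>x\<in>words E n. form (\<xi> + \<eta>) x * f x) =
      (if n = a then \<Sum>x\<in>words E a. form \<xi> x * f x else 0) + (if n = b then \<Sum>x\<in>words E b. form \<eta> x * f x else 0)" for n
    using assms by (auto simp: form_simps tensor_power_degree intro!: sum.cong sum.neutral)
  then show ?thesis using assms(3) by (simp add: sum.distrib)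
qed

text \<open>
  The weight \<open>r ^ length v\<close> in the functional replaces the scaling of the tensors: \<open>\<xi>\<close> picks up \<open>r\<^sup>a\<close> and
  \<open>\<eta>\<close> picks up \<open>r\<^sup>b\<close>; together they act as \<open>r\<^sup>b\<close> times the perturbed kernel.
\<close>

lemma block_eigenvector_extends:
  fixes \<xi> \<eta> u :: "'v tensor_series" and f :: "'v list \<Rightarrow> complex"
  assumes \<xi>: "\<xi> \<in> tensor_power a" and \<eta>: "\<eta> \<in> tensor_power b" and u: "u \<in> tensor_power b"
    and "0 < a" "a < b" "0 < r"
    and eig: "\<And>w. set w \<subseteq> E \<Longrightarrow> length w < b \<Longrightarrow>
      (\<Sum>x\<in>words E b. form \<eta> x * block_functional u b y (x @ w)) +
      of_real (1 / r ^ (b - a)) * (\<Sum>x\<in>words E a. form \<xi> x * block_functional u b y (x @ w)) = z * y w"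
    and "set w \<subseteq> E"
    and f_def: "\<And>v. f v = of_real (r ^ length v) * block_functional u b y v"
  shows "(\<Sum>n\<le>b. \<Sum>x\<in>words E n. form (\<xi> + \<eta>) x * f (x @ w)) = of_real (r ^ b) * z * f w"
proof -
  \<comment> \<open>Split off the blocks of \<open>w\<close>; they contribute the constant factor \<open>\<kappa>\<close>.\<close>
  define w\<^sub>0 c q where "w\<^sub>0 = take (length w mod b) w" and "c = drop (length w mod b) w" and "q = length w div b"
  have w: "w = w\<^sub>0 @ c" "length c = q * b" "length w\<^sub>0 < b" "set w\<^sub>0 \<subseteq> E"
    using \<open>a < b\<close> \<open>set w \<subseteq> E\<close> set_take_subset[of "length w mod b" w]
    by (auto simp: w\<^sub>0_def c_def q_def minus_mod_eq_div_mult)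
  define A where "A = (\<Sum>x\<in>words E a. form \<xi> x * block_functional u b y (x @ w\<^sub>0))"
  define B where "B = (\<Sum>x\<in>words E b. form \<eta> x * block_functional u b y (x @ w\<^sub>0))"
  define \<kappa> where "\<kappa> = (of_real (r ^ length w * form (u ^ q) c) :: complex)"
  have f: "f (x @ w) = of_real (r ^ length x) * \<kappa> * block_functional u b y (x @ w\<^sub>0)" for x
    using block_functional_append[OF u _ w(2), of y "x @ w\<^sub>0"] \<open>a < b\<close> w(1)
    by (simp add: f_def \<kappa>_def power_add mult_ac)
  have "(\<Sum>n\<le>b. \<Sum>x\<in>words E n. form (\<xi> + \<eta>) x * f (x @ w)) =
      (\<Sum>x\<in>words E a. form \<xi> x * f (x @ w)) + (\<Sum>x\<in>words E b. form \<eta> x * f (x @ w))"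
    by (rule sum_degrees_two_homogeneous[OF \<xi> \<eta> \<open>a < b\<close>])
  also have "(\<Sum>x\<in>words E a. form \<xi> x * f (x @ w)) = of_real (r ^ a) * \<kappa> * A"
    unfolding A_def sum_distrib_left by (intro sum.cong) (auto simp: f)
  also have "(\<Sum>x\<in>words E b. form \<eta> x * f (x @ w)) = of_real (r ^ b) * \<kappa> * B"
    unfolding B_def sum_distrib_left by (intro sum.cong) (auto simp: f)
  also have "r ^ a = r ^ b * (1 / r ^ (b - a))"
    using \<open>a < b\<close> \<open>0 < r\<close> by (simp add: power_diff)
  also have "of_real (r ^ b * (1 / r ^ (b - a))) * \<kappa> * A + of_real (r ^ b) * \<kappa> * B =
      of_real (r ^ b) * \<kappa> * (B + of_real (1 / r ^ (b - a)) * A)"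
    by (simp only: of_real_mult) (simp add: algebra_simps)
  also have "B + of_real (1 / r ^ (b - a)) * A = z * y w\<^sub>0"
    unfolding A_def B_def by (rule eig[OF w(4,3)])
  also have "of_real (r ^ b) * \<kappa> * (z * y w\<^sub>0) = of_real (r ^ b) * z * f w"
    by (simp add: f_def \<kappa>_def block_functional_def w\<^sub>0_def c_def q_def mult_ac)
  finally show ?thesis .
qed

text \<open>
  The perturbed eigenvector, extended to all words, is an eigenfunctional of \<open>\<xi> + \<eta>\<close> with eigenvalue
  \<open>r\<^sup>b z\<close> and \<open>z\<close> close to \<open>\<parallel>\<eta>\<parallel>\<close>. It depends on \<open>r\<close>, about which nothing is known beyond the eigenvalue equation;
  evaluating at a word where its modulus is largest keeps the constant \<open>D\<close> independent of \<open>r\<close>.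
\<close>

lemma exp_degree_sum_lower_bound:
  fixes \<xi> \<eta> :: "'v tensor_series"
  assumes \<xi>: "\<xi> \<in> tensor_power a" and \<eta>: "\<eta> \<in> tensor_power b"
    and ab: "0 < a" "a < b" and pos: "0 < hs_norm b \<eta>" and "0 < \<epsilon>"
  shows "\<exists>D>0. \<forall>\<^sub>F r in at_top. \<forall>S. (\<forall>L. (\<Sum>n\<le>L. r ^ n * hs_norm n (tensor_exp (\<xi> + \<eta>))) \<le> S) \<longrightarrow>
    exp (r ^ b * (hs_norm b \<eta> - \<epsilon>)) \<le> D * S"
proof -
  define u where "u = \<eta> /\<^sub>R hs_norm b \<eta>"
  have u: "u \<in> tensor_power b" "hs_norm b u = 1"
    using pos by (auto simp: u_def hs_norm_scaleR intro!: subspace_scale[OF subspace_tensor_power] \<eta>)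
  define I where "I = {w. set w \<subseteq> E \<and> length w < b}"
  have "finite I"
    using finite_lists_length_le[OF finite_basis[OF E], of b] by (rule rev_finite_subset) (auto simp: I_def)
  have "[] \<in> I" using ab by (simp add: I_def)
  let ?F = "block_functional u b"
  let ?\<delta> = "\<lambda>j v. if v = j then 1 else 0 :: complex"
  define A where "A w j = (\<Sum>x\<in>words E b. form \<eta> x * ?F (?\<delta> j) (x @ w))" for w j
  define B where "B w j = (\<Sum>x\<in>words E a. form \<xi> x * ?F (?\<delta> j) (x @ w))" for w j
  have kernel: "(\<Sum>j\<in>I. (\<Sum>x\<in>words E n. form \<zeta> x * ?F (?\<delta> j) (x @ w)) * y j) =
      (\<Sum>x\<in>words E n. form \<zeta> x * ?F y (x @ w))" if "w \<in> I" for n \<zeta> w y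
  proof -
    have "take (length (x @ w) mod b) (x @ w) \<in> I" if "x \<in> words E n" for x
      using that \<open>w \<in> I\<close> ab set_take_subset[of "length (x @ w) mod b" "x @ w"]
      by (simp add: I_def min_less_iff_disj del: take_append) auto
    note lin = block_functional_linear[OF \<open>finite I\<close> this, of _ u y]
    have "(\<Sum>x\<in>words E n. form \<zeta> x * ?F y (x @ w)) =
        (\<Sum>x\<in>words E n. \<Sum>j\<in>I. form \<zeta> x * ?F (?\<delta> j) (x @ w) * y j)"
      by (intro sum.cong refl, subst lin) (simp_all add: sum_distrib_left mult.assoc)
    then show ?thesis unfolding sum_distrib_right by (subst sum.swap) simp
  qed
  have "\<forall>\<^sub>F t in at_right 0. \<exists>z y. norm (z - of_real (hs_norm b \<eta>)) < \<epsilon> \<and> (\<exists>i\<in>I. y i \<noteq> 0) \<and>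
    (\<forall>i\<in>I. (\<Sum>j\<in>I. (A i j + of_real t * B i j) * y j) = z * y i)"
  proof (rule eigenvalue_perturbation[OF \<open>finite I\<close> \<open>[] \<in> I\<close>, of "?\<delta> []"])
    show "(\<Sum>j\<in>I. A i j * ?\<delta> [] j) = of_real (hs_norm b \<eta>) * ?\<delta> [] i" if "i \<in> I" for i
    proof -
      have "(\<Sum>j\<in>I. A i j * ?\<delta> [] j) = (\<Sum>x\<in>words E b. form \<eta> x * ?F (?\<delta> []) (x @ i))"
        unfolding A_def by (rule kernel[OF that])
      also have "\<dots> = of_real (hs_norm b \<eta>) * ?\<delta> [] i"
        unfolding u_def using block_functional_empty_word_eigen[OF \<eta> pos] ab that by (simp add: I_def)
      finally show ?thesis .
    qed
  qed (use \<open>0 < \<epsilon>\<close> in auto)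
  moreover have "filterlim (\<lambda>r::real. 1 / r ^ (b - a)) (at_right 0) at_top"
    using ab by real_asymp
  ultimately have ev: "\<forall>\<^sub>F r in at_top. \<exists>z y. norm (z - of_real (hs_norm b \<eta>)) < \<epsilon> \<and> (\<exists>i\<in>I. y i \<noteq> 0) \<and>
    (\<forall>i\<in>I. (\<Sum>j\<in>I. (A i j + of_real (1 / r ^ (b - a)) * B i j) * y j) = z * y i)"
    by (rule eventually_compose_filterlim)
  have "\<forall>\<^sub>F r in at_top. \<forall>S. (\<forall>L. (\<Sum>n\<le>L. r ^ n * hs_norm n (tensor_exp (\<xi> + \<eta>))) \<le> S) \<longrightarrow>
    exp (r ^ b * (hs_norm b \<eta> - \<epsilon>)) \<le> sqrt (card I) * S"
    using ev eventually_gt_at_top[of 0]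
  proof eventually_elim
    case (elim r)
    then obtain z y where z: "norm (z - of_real (hs_norm b \<eta>)) < \<epsilon>" and nz: "\<exists>i\<in>I. y i \<noteq> 0"
      and yz: "\<And>i. i \<in> I \<Longrightarrow> (\<Sum>j\<in>I. (A i j + of_real (1 / r ^ (b - a)) * B i j) * y j) = z * y i"
      by blast
    have "0 < r" by fact
    define f :: "'v list \<Rightarrow> complex" where "f v = of_real (r ^ length v) * ?F y v" for v
    have eig0: "(\<Sum>x\<in>words E b. form \<eta> x * ?F y (x @ w)) +
      of_real (1 / r ^ (b - a)) * (\<Sum>x\<in>words E a. form \<xi> x * ?F y (x @ w)) = z * y w"
      if "set w \<subseteq> E" "length w < b" for w
    proof -
      have "w \<in> I" using that by (simp add: I_def)
      have "(\<Sum>j\<in>I. (A w j + of_real (1 / r ^ (b - a)) * B w j) * y j) =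
          (\<Sum>j\<in>I. A w j * y j) + of_real (1 / r ^ (b - a)) * (\<Sum>j\<in>I. B w j * y j)"
        by (simp add: algebra_simps sum.distrib sum_distrib_left)
      then show ?thesis
        using yz[OF \<open>w \<in> I\<close>] unfolding A_def B_def kernel[OF \<open>w \<in> I\<close>] by simp
    qed
    have eig: "(\<Sum>n\<le>b. \<Sum>x\<in>words E n. form (\<xi> + \<eta>) x * f (x @ w)) = of_real (r ^ b) * z * f w"
      if "set w \<subseteq> E" for w
      by (rule block_eigenvector_extends[OF \<xi> \<eta> u(1) ab \<open>0 < r\<close> eig0 that f_def])
    define Y where "Y = Max ((\<lambda>i. norm (y i)) ` I)"
    have Y: "norm (y i) \<le> Y" if "i \<in> I" for i
      unfolding Y_def using \<open>finite I\<close> that by simp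
    have "Y \<in> (\<lambda>i. norm (y i)) ` I"
      unfolding Y_def using \<open>finite I\<close> \<open>[] \<in> I\<close> by (intro Max_in) auto
    then obtain w where w: "w \<in> I" "norm (y w) = Y" by auto
    have "0 < Y" using nz Y by (metis norm_le_zero_iff not_le order.trans)
    define C where "C = r ^ length w * (sqrt (card I) * Y)"
    have growth: "(\<Sum>x\<in>words E n. (norm (f (x @ w)))\<^sup>2) \<le> (C * r ^ n)\<^sup>2" for n
    proof -
      let ?n = "n + length w"
      have "(\<Sum>x\<in>words E n. (norm (f (x @ w)))\<^sup>2) = (r ^ ?n)\<^sup>2 * (\<Sum>x\<in>words E n. (norm (?F y (x @ w)))\<^sup>2)"
        unfolding sum_distrib_left
        using \<open>0 < r\<close> by (intro sum.cong) (auto simp: f_def norm_mult norm_power power_mult_distrib)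
      also have "(\<Sum>x\<in>words E n. (norm (?F y (x @ w)))\<^sup>2) = (\<Sum>v\<in>(\<lambda>x. x @ w) ` words E n. (norm (?F y v))\<^sup>2)"
        by (subst sum.reindex) (auto simp: inj_on_def)
      also have "\<dots> \<le> (\<Sum>v\<in>words E ?n. (norm (?F y v))\<^sup>2)"
        using w(1) finite_words[OF E] by (intro sum_mono2) (auto simp: I_def)
      also have "\<dots> = (\<Sum>v\<in>words E (?n mod b). (norm (y v))\<^sup>2)"
        by (rule sum_block_functional_norm[OF E u])
      also have "\<dots> \<le> (\<Sum>v\<in>I. (norm (y v))\<^sup>2)"
        using \<open>finite I\<close> ab by (intro sum_mono2) (auto simp: I_def)
      also have "\<dots> \<le> (\<Sum>v\<in>I. Y\<^sup>2)"
        using Y by (intro sum_mono power_mono) auto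
      also have "(r ^ ?n)\<^sup>2 * (\<Sum>v\<in>I. Y\<^sup>2) = (C * r ^ n)\<^sup>2"
        by (simp add: C_def power_mult_distrib power_add)
      finally show ?thesis by (simp add: mult_left_mono)
    qed
    show ?case
    proof (intro allI impI)
      fix S assume S: "\<forall>L. (\<Sum>n\<le>L. r ^ n * hs_norm n (tensor_exp (\<xi> + \<eta>))) \<le> S"
      have deg: "form (\<xi> + \<eta>) [] = 0" "b < length ws \<Longrightarrow> form (\<xi> + \<eta>) ws = 0" for ws
        using \<xi> \<eta> ab by (simp_all add: form_simps tensor_power_degree)
      have "norm (exp (of_real (r ^ b) * z) * f w) \<le> C * S"
      proof (rule norm_exp_eigenfunctional_le[OF E deg _ eig _ _ _ growth])
        show "(\<Sum>n\<le>L. r ^ n * hs_norm n (\<xi> + \<eta>)) \<le> r ^ a * hs_norm a \<xi> + r ^ b * hs_norm b \<eta>" for L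
          using degree_sum_two_homogeneous_le[OF \<xi> \<eta>] \<open>0 < r\<close> by simp
      qed (use w ab \<open>0 < r\<close> \<open>0 < Y\<close> S in \<open>auto simp: I_def C_def\<close>)
      moreover have "norm (f w) = r ^ length w * Y"
        using w \<open>0 < r\<close> by (simp add: f_def block_functional_def I_def norm_mult norm_power form_simps)
      moreover have "norm (exp (of_real (r ^ b) * z)) = exp (r ^ b * Re z)"
        by (simp del: of_real_power)
      ultimately have "exp (r ^ b * Re z) * (r ^ length w * Y) \<le> (sqrt (card I) * S) * (r ^ length w * Y)"
        by (simp only: norm_mult C_def mult_ac)
      then have "exp (r ^ b * Re z) \<le> sqrt (card I) * S"
        using \<open>0 < r\<close> \<open>0 < Y\<close> by simp
      moreover have "hs_norm b \<eta> - \<epsilon> \<le> Re z"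
        using z abs_Re_le_cmod[of "z - of_real (hs_norm b \<eta>)"] by simp
      ultimately show "exp (r ^ b * (hs_norm b \<eta> - \<epsilon>)) \<le> sqrt (card I) * S"
        using \<open>0 < r\<close> by (auto elim!: order_trans[rotated])
    qed
  qed
  moreover have "0 < sqrt (card I)"
    using \<open>finite I\<close> \<open>[] \<in> I\<close> by (auto simp: card_gt_0_iff)
  ultimately show ?thesis by blast
qed

end

section \<open>From exponential growth to root asymptotics\<close>

text \<open>
  With \<open>x = s/b + 1\<close> for the remainder \<open>s\<close> of \<open>n\<close>, the recursion for the Gamma function gives
  \<open>\<Gamma>(x + q) = x (x + 1) \<dots> (x + q - 1) \<Gamma>(x)\<close>, and \<open>x \<ge> 1\<close>; only finitely many values \<open>\<Gamma>(x)\<close> occur.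
\<close>

lemma fact_le_Gamma:
  assumes "0 < (b::nat)"
  shows "\<exists>c>0. \<forall>n. c * fact (n div b) \<le> Gamma (real n / real b + 1)"
proof -
  define c where "c = Min ((\<lambda>s. Gamma (real s / real b + 1)) ` {..<b})"
  have c: "c \<le> Gamma (real s / real b + 1)" if "s < b" for s
    unfolding c_def using that by simp
  have "c \<in> (\<lambda>s. Gamma (real s / real b + 1)) ` {..<b}"
    unfolding c_def using assms by (intro Min_in) auto
  then have "0 < c" by (auto intro!: Gamma_real_pos add_nonneg_pos)
  have "c * fact (n div b) \<le> Gamma (real n / real b + 1)" for n
  proof -
    define q s where "q = n div b" and "s = n mod b"
    define x where "x = real s / real b + 1"
    have "1 \<le> x" by (simp add: x_def)
    have "real n = real q * real b + real s"
      unfolding q_def s_def by (metis div_mult_mod_eq of_nat_add of_nat_mult)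
    then have n: "real n / real b + 1 = x + real q"
      using assms by (simp add: x_def field_simps)
    have "x \<notin> \<int>\<^sub>\<le>\<^sub>0" using \<open>1 \<le> x\<close> by (auto elim!: nonpos_Ints_cases)
    moreover have "0 < Gamma x" using \<open>1 \<le> x\<close> by (intro Gamma_real_pos) simp
    ultimately have "Gamma (x + real q) = pochhammer x q * Gamma x"
      using pochhammer_Gamma[of x q] by simp
    moreover have "fact q \<le> pochhammer x q"
      unfolding pochhammer_fact pochhammer_prod using \<open>1 \<le> x\<close> by (intro prod_mono) auto
    moreover have "c \<le> Gamma x"
      unfolding x_def using assms by (intro c) (simp add: s_def)
    ultimately show ?thesis
      unfolding n q_def[symmetric] using \<open>0 < c\<close> by (simp add: mult.commute mult_mono)
  qed
  then show ?thesis using \<open>0 < c\<close> by blast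
qed

lemma sum_div_le:
  fixes g :: "nat \<Rightarrow> real"
  assumes "0 < b" "\<And>q. 0 \<le> g q"
  shows "(\<Sum>n\<le>L. g (n div b)) \<le> real b * (\<Sum>q\<le>L. g q)"
proof -
  have "L < Suc L * b" using assms(1) by (cases b) auto
  then have "(\<Sum>n\<le>L. g (n div b)) \<le> (\<Sum>n<Suc L * b. g (n div b))"
    using assms(2) by (intro sum_mono2) auto
  also have "\<dots> = (\<Sum>q<Suc L. \<Sum>n = q * b..<q * b + b. g (n div b))"
    by (rule sum.nat_group[symmetric])
  also have "\<dots> = (\<Sum>q<Suc L. \<Sum>n = q * b..<q * b + b. g q)"
    by (intro sum.cong refl arg_cong[of _ _ g]) (auto intro!: div_nat_eqI simp: mult.commute)
  finally show ?thesis by (simp add: sum_distrib_left lessThan_Suc_atMost)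
qed

text \<open>
  A crude bound for a Mittag-Leffler function: grouping the terms by \<open>n div b\<close> compares the series of
  \<open>\<tau>\<^bsup>n/b\<^esup> / \<Gamma>(n/b + 1)\<close>, where \<open>\<tau> = r\<^sup>b \<beta>\<close>, with \<open>b\<close> copies of the exponential series, the fractional
  power costing a factor \<open>1 + \<tau>\<close>.
\<close>

lemma power_sum_le_of_Gamma_bound:
  fixes h :: "nat \<Rightarrow> real"
  assumes "0 < b" "0 < \<beta>" "0 \<le> K"
    and h: "\<And>n. Gamma (real n / real b + 1) * h n \<le> K * \<beta> powr (real n / real b)"
  shows "\<exists>M. \<forall>r\<ge>0. \<forall>L. (\<Sum>n\<le>L. r ^ n * h n) \<le> M * (1 + r ^ b * \<beta>) * exp (r ^ b * \<beta>)"
proof -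
  obtain c where c: "0 < c" "\<And>n. c * fact (n div b) \<le> Gamma (real n / real b + 1)"
    using fact_le_Gamma[OF assms(1)] by blast
  have "(\<Sum>n\<le>L. r ^ n * h n) \<le> (K / c * b) * (1 + r ^ b * \<beta>) * exp (r ^ b * \<beta>)" if "0 \<le> r" for r L
  proof -
    define \<rho> where "\<rho> = r * \<beta> powr (1 / b)"
    define \<tau> where "\<tau> = r ^ b * \<beta>"
    have "0 \<le> \<rho>" "0 \<le> \<tau>" using assms that by (auto simp: \<rho>_def \<tau>_def)
    have \<rho>: "\<rho> ^ b = \<tau>"
      using assms by (simp add: \<rho>_def \<tau>_def power_mult_distrib powr_power)
    have "r ^ n * h n \<le> K / c * (1 + \<tau>) * (\<tau> ^ (n div b) / fact (n div b))" for n
    proof -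
      have G: "0 < Gamma (real n / real b + 1)" by (auto intro!: Gamma_real_pos add_nonneg_pos)
      have "h n \<le> K * \<beta> powr (real n / real b) / Gamma (real n / real b + 1)"
        using h[of n] G by (simp add: field_simps)
      also have "\<dots> \<le> K * \<beta> powr (real n / real b) / (c * fact (n div b))"
        using assms c by (intro divide_left_mono mult_pos_pos G) auto
      finally have "r ^ n * h n \<le> r ^ n * (K * \<beta> powr (real n / real b) / (c * fact (n div b)))"
        using that by (intro mult_left_mono) auto
      also have "\<dots> = K / c * \<rho> ^ n / fact (n div b)"
        using assms by (simp add: \<rho>_def power_mult_distrib powr_power)
      also have "\<rho> ^ n = \<rho> ^ (n mod b) * \<tau> ^ (n div b)"
        by (simp flip: \<rho> power_mult power_add)
      also have "\<rho> ^ (n mod b) \<le> 1 + \<tau>"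
      proof (cases "\<rho> \<le> 1")
        case True
        then show ?thesis using power_le_one[OF \<open>0 \<le> \<rho>\<close> True, of "n mod b"] \<open>0 \<le> \<tau>\<close> by linarith
      next
        case False
        then have "\<rho> ^ (n mod b) \<le> \<rho> ^ b"
          using assms by (intro power_increasing) auto
        then show ?thesis using \<rho> by simp
      qed
      finally show ?thesis
        using assms c \<open>0 \<le> \<tau>\<close> by (simp add: mult_left_mono mult_right_mono divide_right_mono mult.assoc)
    qed
    then have "(\<Sum>n\<le>L. r ^ n * h n) \<le> K / c * (1 + \<tau>) * (\<Sum>n\<le>L. \<tau> ^ (n div b) / fact (n div b))"
      unfolding sum_distrib_left by (intro sum_mono)
    also have "\<dots> \<le> K / c * (1 + \<tau>) * (b * (\<Sum>q\<le>L. \<tau> ^ q / fact q))"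
      using assms c \<open>0 \<le> \<tau>\<close> sum_div_le[where g = "\<lambda>q. \<tau> ^ q / fact q" and b = b and L = L]
      by (intro mult_left_mono) auto
    also have "\<dots> \<le> K / c * (1 + \<tau>) * (b * exp \<tau>)"
    proof -
      have "(\<Sum>q\<le>L. \<tau> ^ q / fact q) \<le> (\<Sum>q. \<tau> ^ q /\<^sub>R fact q)"
        using summable_exp_generic[of \<tau>] \<open>0 \<le> \<tau>\<close>
        by (intro order_trans[OF _ sum_le_suminf[of _ "{..L}"]] sum_mono) (auto simp: field_simps)
      then show ?thesis
        using assms c \<open>0 \<le> \<tau>\<close> by (intro mult_left_mono) (auto simp: exp_def)
    qed
    finally show ?thesis by (simp add: \<tau>_def mult_ac)
  qed
  then show ?thesis by blast
qed

text \<open>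
  With \<open>t = \<beta> r\<^sup>b\<close> the hypothesis says \<open>t\<^bsup>n/b\<^esup> h n \<le> \<beta>\<^bsup>n/b\<^esup> exp (M + (1 - \<delta>) t)\<close>, once the term of
  lower order \<open>r\<^sup>a A\<close> is absorbed into \<open>M + \<epsilon> r\<^sup>b\<close>. Multiplying by \<open>exp (- t)\<close> and integrating over \<open>t\<close> gives
  the Gamma function on the left and a finite constant on the right.
\<close>

lemma Gamma_bound_of_exp_bound:
  fixes h :: "nat \<Rightarrow> real"
  assumes "0 < a" "a < b" "0 \<le> A" "0 \<le> N" "N < \<beta>"
    and h: "\<And>n r. 0 \<le> r \<Longrightarrow> r ^ n * h n \<le> exp (r ^ a * A + r ^ b * N)"
  shows "\<exists>K>0. \<forall>n. Gamma (real n / real b + 1) * h n \<le> K * \<beta> powr (real n / real b)"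
proof -
  \<comment> \<open>The gap between \<open>N\<close> and \<open>\<beta>\<close> is spent in two halves: one absorbs \<open>r\<^sup>a A\<close>, the other makes the integral
    converge.\<close>
  define \<epsilon> where "\<epsilon> = (\<beta> - N) / 2"
  have "0 < \<epsilon>" "0 < \<beta>" using assms by (auto simp: \<epsilon>_def)
  define \<delta> where "\<delta> = \<epsilon> / \<beta>"
  have "0 < \<delta>" using \<open>0 < \<epsilon>\<close> \<open>0 < \<beta>\<close> by (simp add: \<delta>_def)
  have "\<forall>\<^sub>F r in at_top. A \<le> \<epsilon> * r ^ (b - a)"
  proof -
    have "filterlim (\<lambda>r. \<epsilon> * r ^ (b - a)) at_top at_top"
      using assms \<open>0 < \<epsilon>\<close>
      by (intro filterlim_tendsto_pos_mult_at_top[OF tendsto_const] filterlim_pow_at_top filterlim_ident) auto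
    then show ?thesis by (simp add: filterlim_at_top)
  qed
  then obtain R where R: "\<And>r. R \<le> r \<Longrightarrow> A \<le> \<epsilon> * r ^ (b - a)"
    by (auto simp: eventually_at_top_linorder)
  define M where "M = \<bar>R\<bar> ^ a * A"
  have "0 \<le> M" using assms by (simp add: M_def)
  have dominated: "r ^ a * A \<le> M + \<epsilon> * r ^ b" if "0 \<le> r" for r
  proof (cases "R \<le> r")
    case True
    then have "r ^ a * A \<le> r ^ a * (\<epsilon> * r ^ (b - a))"
      using that by (intro mult_left_mono R) auto
    also have "\<dots> = \<epsilon> * r ^ b" using assms by (simp flip: power_add)
    finally show ?thesis using \<open>0 \<le> M\<close> by simp
  next
    case False
    then have "r ^ a * A \<le> M"
      unfolding M_def using that assms by (intro mult_right_mono power_mono) auto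
    then show ?thesis using that \<open>0 < \<epsilon>\<close> by (simp add: add_increasing2)
  qed
  have "Gamma (real n / real b + 1) * h n \<le> exp M / \<delta> * \<beta> powr (real n / real b)" for n
  proof -
    define x where "x = real n / real b"
    have "((\<lambda>t. t powr x / exp t) has_integral Gamma (x + 1)) {0..}"
      using Gamma_integral_real[of "x + 1"] assms by (simp add: x_def add_nonneg_pos)
    then have 1: "((\<lambda>t. t powr x / exp t * h n) has_integral Gamma (x + 1) * h n) {0..}"
      by (rule has_integral_mult_left)
    have "((\<lambda>t. exp (- \<delta> * t)) has_integral 1 / \<delta>) {0..}"
      using has_integral_exp_minus_to_infinity[OF \<open>0 < \<delta>\<close>, of 0] by simp
    then have 2: "((\<lambda>t. (exp M * \<beta> powr x) * exp (- \<delta> * t)) has_integral (exp M * \<beta> powr x) * (1 / \<delta>)) {0..}"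
      by (rule has_integral_mult_right)
    have "t powr x / exp t * h n \<le> (exp M * \<beta> powr x) * exp (- \<delta> * t)" if "t \<in> {0..}" for t
    proof (cases "t = 0")
      case True
      then show ?thesis by simp
    next
      case False
      then have "0 < t" using that by simp
      define r where "r = (t / \<beta>) powr (1 / b)"
      have "0 \<le> r" by (simp add: r_def)
      have rn: "r ^ n = t powr x / \<beta> powr x"
      proof -
        have "r ^ n = (t / \<beta>) powr x" using \<open>0 < t\<close> \<open>0 < \<beta>\<close> by (simp add: r_def x_def powr_power)
        then show ?thesis using \<open>0 < t\<close> \<open>0 < \<beta>\<close> by (simp add: powr_divide)
      qed
      have rb: "r ^ b = t / \<beta>"
        using \<open>0 < t\<close> \<open>0 < \<beta>\<close> assms by (simp add: r_def powr_power)
      have "r ^ n * h n \<le> exp (r ^ a * A + r ^ b * N)"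
        by (rule h[OF \<open>0 \<le> r\<close>])
      also have "\<dots> \<le> exp (M + (t - \<delta> * t))"
      proof -
        have "\<epsilon> * (t / \<beta>) + t / \<beta> * N = t - \<delta> * t"
          using \<open>0 < \<beta>\<close> by (simp add: \<delta>_def \<epsilon>_def field_simps)
        then show ?thesis using dominated[OF \<open>0 \<le> r\<close>] by (simp add: rb)
      qed
      also have "\<dots> = exp M * exp (- \<delta> * t) * exp t"
        by (simp flip: exp_add)
      finally show ?thesis
        using \<open>0 < \<beta>\<close> by (simp add: rn divide_simps mult_ac)
    qed
    then have "Gamma (x + 1) * h n \<le> (exp M * \<beta> powr x) * (1 / \<delta>)"
      by (rule has_integral_le[OF 1 2])
    then show ?thesis by (simp add: x_def)
  qed
  moreover have "0 < exp M / \<delta>" using \<open>0 < \<delta>\<close> by simp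
  ultimately show ?thesis by blast
qed

text \<open>
  A constant factor \<open>K\<close> turns into \<open>K\<^bsup>b/n\<^esup>\<close>, which tends to one: bounds up to constants determine the
  limit superior.
\<close>

lemma limsup_root_eq:
  fixes g :: "nat \<Rightarrow> real" and N :: real
  assumes "0 < b" "0 \<le> N" and g: "\<And>n. 0 \<le> g n"
    and upper: "\<And>\<beta>. N < \<beta> \<Longrightarrow> \<exists>K>0. \<forall>n. g n \<le> K * \<beta> powr (real n / real b)"
    and lower: "\<And>\<beta> K. 0 < \<beta> \<Longrightarrow> \<beta> < N \<Longrightarrow> 0 < K \<Longrightarrow> \<exists>n. K * \<beta> powr (real n / real b) < g n"
  shows "limsup (\<lambda>n. ereal (g n powr (real b / real n))) = ereal N"
proof (rule antisym)
  have "limsup (\<lambda>n. ereal (g n powr (real b / real n))) \<le> ereal \<beta>" if \<beta>: "N < \<beta>" for \<beta>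
  proof -
    obtain K where K: "0 < K" "\<And>n. g n \<le> K * \<beta> powr (real n / real b)"
      using upper[OF \<beta>] by blast
    have "0 < \<beta>" using that assms by simp
    have "\<forall>\<^sub>F n in sequentially. ereal (g n powr (real b / real n)) \<le> ereal (K powr (real b / real n) * \<beta>)"
      using eventually_gt_at_top[of 0]
    proof eventually_elim
      case (elim n)
      have "g n powr (real b / real n) \<le> (K * \<beta> powr (real n / real b)) powr (real b / real n)"
        using K g by (intro powr_mono2) auto
      also have "\<dots> = K powr (real b / real n) * \<beta>"
        using K \<open>0 < \<beta>\<close> elim assms by (simp add: powr_mult powr_powr)
      finally show ?case by simp
    qed
    then have "limsup (\<lambda>n. ereal (g n powr (real b / real n))) \<le> limsup (\<lambda>n. ereal (K powr (real b / real n) * \<beta>))"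
      by (rule Limsup_mono)
    also have "(\<lambda>n. ereal (K powr (real b / real n) * \<beta>)) \<longlonglongrightarrow> ereal (K powr 0 * \<beta>)"
      using K by (intro tendsto_intros real_tendsto_divide_at_top[OF tendsto_const] filterlim_real_sequentially) auto
    then have "limsup (\<lambda>n. ereal (K powr (real b / real n) * \<beta>)) = ereal \<beta>"
      using K by (intro lim_imp_Limsup) auto
    finally show ?thesis .
  qed
  then show "limsup (\<lambda>n. ereal (g n powr (real b / real n))) \<le> ereal N"
    using ereal_dense2[of "ereal N" "limsup (\<lambda>n. ereal (g n powr (real b / real n)))"]
    by (force simp: not_le[symmetric])
next
  show "ereal N \<le> limsup (\<lambda>n. ereal (g n powr (real b / real n)))"
  proof (rule ccontr)
    assume "\<not> ?thesis"
    then have lt: "limsup (\<lambda>n. ereal (g n powr (real b / real n))) < ereal N" by simp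
    have "0 \<le> limsup (\<lambda>n. ereal (g n powr (real b / real n)))"
      by (intro le_Limsup) auto
    moreover obtain \<beta> where \<beta>: "limsup (\<lambda>n. ereal (g n powr (real b / real n))) < ereal \<beta>" "\<beta> < N"
      using ereal_dense2[OF lt] by auto
    ultimately have "0 < \<beta>" by (metis ereal_less(2) order.strict_trans1 zero_ereal_def)
    obtain n\<^sub>0 where n\<^sub>0: "\<And>n. n\<^sub>0 \<le> n \<Longrightarrow> g n powr (real b / real n) < \<beta>"
      using Limsup_lessD[OF \<beta>(1)] by (auto simp: eventually_sequentially)
    \<comment> \<open>The sum takes care of the finitely many exceptions, among them \<open>n = 0\<close>, where \<open>b / n\<close> is zero.\<close>
    define K where "K = 1 + (\<Sum>n\<le>n\<^sub>0. g n / \<beta> powr (real n / real b))"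
    have "1 \<le> K" unfolding K_def using g by (simp add: sum_nonneg)
    have "g n \<le> K * \<beta> powr (real n / real b)" for n
    proof (cases "n\<^sub>0 < n")
      case True
      then have "g n = (g n powr (real b / real n)) powr (real n / real b)"
        using g[of n] assms by (simp add: powr_powr)
      also have "\<dots> \<le> \<beta> powr (real n / real b)"
        using n\<^sub>0[of n] True by (intro powr_mono2) auto
      also have "\<dots> \<le> K * \<beta> powr (real n / real b)"
        using \<open>1 \<le> K\<close> by (simp add: mult_le_cancel_right1)
      finally show ?thesis .
    next
      case False
      then have "g n / \<beta> powr (real n / real b) \<le> (\<Sum>n\<le>n\<^sub>0. g n / \<beta> powr (real n / real b))"
        using g by (intro member_le_sum) auto
      then have "g n / \<beta> powr (real n / real b) \<le> K" by (simp add: K_def)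
      then show ?thesis using \<open>0 < \<beta>\<close> by (simp add: field_simps)
    qed
    then show False using lower[OF \<open>0 < \<beta>\<close> \<open>\<beta> < N\<close>, of K] \<open>1 \<le> K\<close> by (auto simp: not_less[symmetric])
  qed
qed

context
  fixes E :: "'v::real_inner set"
  assumes E: "orthonormal_basis E"
begin

lemma limsup_exp_two_homogeneous:
  fixes \<xi> \<eta> :: "'v tensor_series"
  assumes \<xi>: "\<xi> \<in> tensor_power a" and \<eta>: "\<eta> \<in> tensor_power b" and ab: "0 < a" "a < b"
  shows "limsup (\<lambda>n. ereal ((Gamma (real n / real b + 1) * hs_norm n (tensor_exp (\<xi> + \<eta>))) powr (real b / real n)))
    = ereal (hs_norm b \<eta>)"
proof (rule limsup_root_eq)
  define h where "h n = hs_norm n (tensor_exp (\<xi> + \<eta>))" for n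
  show "0 \<le> Gamma (real n / real b + 1) * hs_norm n (tensor_exp (\<xi> + \<eta>))" for n
    by (auto intro!: mult_nonneg_nonneg Gamma_real_nonneg add_nonneg_pos)
  show "\<exists>K>0. \<forall>n. Gamma (real n / real b + 1) * hs_norm n (tensor_exp (\<xi> + \<eta>)) \<le> K * \<beta> powr (real n / real b)"
    if "hs_norm b \<eta> < \<beta>" for \<beta>
  proof (rule Gamma_bound_of_exp_bound[OF ab _ _ that])
    fix n and r :: real assume "0 \<le> r"
    have "r ^ n * hs_norm n (tensor_exp (\<xi> + \<eta>)) \<le> (\<Sum>k\<le>n. r ^ k * hs_norm k (tensor_exp (\<xi> + \<eta>)))"
      using \<open>0 \<le> r\<close> by (intro member_le_sum) auto
    also have "\<dots> \<le> exp (r ^ a * hs_norm a \<xi> + r ^ b * hs_norm b \<eta>)"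
      using \<xi> \<eta> ab by (intro degree_sum_exp_le[OF E \<open>0 \<le> r\<close>] degree_sum_two_homogeneous_le[OF \<xi> \<eta> \<open>0 \<le> r\<close>])
        (simp add: form_simps tensor_power_degree)
    finally show "r ^ n * hs_norm n (tensor_exp (\<xi> + \<eta>)) \<le> exp (r ^ a * hs_norm a \<xi> + r ^ b * hs_norm b \<eta>)" .
  qed auto
  show "\<exists>n. K * \<beta> powr (real n / real b) < Gamma (real n / real b + 1) * hs_norm n (tensor_exp (\<xi> + \<eta>))"
    if \<beta>: "0 < \<beta>" "\<beta> < hs_norm b \<eta>" and K: "0 < K" for \<beta> K
  proof (rule ccontr)
    assume "\<not> ?thesis"
    then have "\<And>n. Gamma (real n / real b + 1) * h n \<le> K * \<beta> powr (real n / real b)"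
      by (auto simp: not_less h_def)
    then obtain M where M: "\<And>r L. 0 \<le> r \<Longrightarrow> (\<Sum>n\<le>L. r ^ n * h n) \<le> M * (1 + r ^ b * \<beta>) * exp (r ^ b * \<beta>)"
      using power_sum_le_of_Gamma_bound[of b \<beta> K h] \<beta> K ab by auto
    define \<epsilon> where "\<epsilon> = (hs_norm b \<eta> - \<beta>) / 2"
    have \<epsilon>: "0 < \<epsilon>" "hs_norm b \<eta> - \<epsilon> = \<beta> + \<epsilon>" using \<beta> by (auto simp: \<epsilon>_def field_simps)
    have pos: "0 < hs_norm b \<eta>" using \<beta> by simp
    obtain D where D: "0 < D" "\<forall>\<^sub>F r in at_top. \<forall>S. (\<forall>L. (\<Sum>n\<le>L. r ^ n * h n) \<le> S) \<longrightarrow>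
        exp (r ^ b * (\<beta> + \<epsilon>)) \<le> D * S"
      using exp_degree_sum_lower_bound[OF E \<xi> \<eta> ab pos \<epsilon>(1), folded h_def, unfolded \<epsilon>(2)] by blast
    have "\<forall>\<^sub>F x in at_top. D * (M * (1 + x * \<beta>)) < exp (x * \<epsilon>)"
      using \<open>0 < \<epsilon>\<close> by real_asymp
    moreover have "filterlim (\<lambda>r::real. r ^ b) at_top at_top"
      using ab by (intro filterlim_pow_at_top filterlim_ident) auto
    ultimately have "\<forall>\<^sub>F r in at_top. D * (M * (1 + r ^ b * \<beta>)) < exp (r ^ b * \<epsilon>)"
      by (rule eventually_compose_filterlim)
    with D(2) eventually_ge_at_top[of 0] have "\<forall>\<^sub>F r :: real in at_top. False"
    proof eventually_elim
      case (elim r)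
      have "exp (r ^ b * \<epsilon>) * exp (r ^ b * \<beta>) = exp (r ^ b * (\<beta> + \<epsilon>))"
        by (simp add: algebra_simps flip: exp_add)
      also have "\<dots> \<le> D * (M * (1 + r ^ b * \<beta>) * exp (r ^ b * \<beta>))"
        using elim M by blast
      also have "\<dots> = D * (M * (1 + r ^ b * \<beta>)) * exp (r ^ b * \<beta>)" by simp
      also have "\<dots> < exp (r ^ b * \<epsilon>) * exp (r ^ b * \<beta>)"
        using elim by (intro mult_strict_right_mono) auto
      finally show False by simp
    qed
    then show False by simp
  qed
qed (use ab in auto)

end

section \<open>The path and its increments\<close>

lemma trunc_trunc: "trunc n (trunc n \<xi>) = trunc n \<xi>"
  by (rule tensor_series_eqI) (simp add: trunc.rep_eq)

lemma trunc_one: "trunc n 1 = 1"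
  by (rule tensor_series_eqI) (auto simp: trunc.rep_eq form_simps)

lemma trunc_mult_left: "trunc n (trunc n \<xi> * \<eta>) = trunc n (\<xi> * \<eta>)"
  using trunc_mult[of n "trunc n \<xi>" \<eta>] trunc_mult[of n \<xi> \<eta>] by (simp add: trunc_trunc)

lemma trunc_mult_right: "trunc n (\<xi> * trunc n \<eta>) = trunc n (\<xi> * \<eta>)"
  using trunc_mult[of n \<xi> "trunc n \<eta>"] trunc_mult[of n \<xi> \<eta>] by (simp add: trunc_trunc)

text \<open>
  The truncated product is associative, so a two-sided inverse is unique.
\<close>

lemma truncated_inverse_eqI:
  assumes "\<eta> \<in> truncated_algebra n" "trunc n (\<xi> * \<eta>) = 1" "trunc n (\<eta> * \<xi>) = 1"
  shows "truncated_inverse n \<xi> = \<eta>"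
  unfolding truncated_inverse_def
proof (rule the_equality)
  fix \<zeta> assume \<zeta>: "\<zeta> \<in> truncated_algebra n \<and> trunc n (\<xi> * \<zeta>) = 1 \<and> trunc n (\<zeta> * \<xi>) = 1"
  have "\<zeta> = trunc n (\<zeta> * trunc n (\<xi> * \<eta>))"
    using assms \<zeta> by (simp add: truncated_algebra_def)
  also have "\<dots> = trunc n (trunc n (\<zeta> * \<xi>) * \<eta>)"
    by (simp add: trunc_mult_left trunc_mult_right mult.assoc)
  also have "\<dots> = \<eta>"
    using assms \<zeta> by (simp add: truncated_algebra_def)
  finally show "\<zeta> = \<eta>" .
qed (use assms in simp)

lemma truncated_exp_inverse:
  assumes "form \<xi> [] = 0"
  shows "truncated_inverse n (truncated_exp n (s *\<^sub>R \<xi>)) = truncated_exp n ((- s) *\<^sub>R \<xi>)"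
  using tensor_exp_add[OF assms, of s "- s"] tensor_exp_add[OF assms, of "- s" s]
  by (intro truncated_inverse_eqI)
     (simp_all add: truncated_algebra_def truncated_exp_def trunc_trunc trunc_mult tensor_exp_0 trunc_one)

lemma path_increments_exp:
  assumes "form \<xi> [] = 0" "x s = truncated_exp n (s *\<^sub>R \<xi>)" "x t = truncated_exp n (t *\<^sub>R \<xi>)"
  shows "path_increments n x s t = trunc n (tensor_exp ((t - s) *\<^sub>R \<xi>))"
  unfolding path_increments_def assms(2,3) truncated_exp_inverse[OF assms(1)]
  using tensor_exp_add[OF assms(1), of "- s" t] by (simp add: truncated_exp_def trunc_mult)

section \<open>Variation\<close>

lemma partitions_nth:
  assumes "ts \<in> partitions T" "i < length ts - 1"
  shows "0 \<le> ts ! i" "ts ! i \<le> ts ! Suc i" "ts ! Suc i \<le> T"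
proof -
  from assms have ts: "ts \<noteq> []" "sorted_wrt (<) ts" "ts ! 0 = 0" "ts ! (length ts - 1) = T"
    by (auto simp: partitions_def hd_conv_nth last_conv_nth)
  have mono: "ts ! j \<le> ts ! k" if "j \<le> k" "k < length ts" for j k
    using sorted_wrt_nth_less[OF ts(2), of j k] that by (cases "j = k") auto
  show "0 \<le> ts ! i" "ts ! i \<le> ts ! Suc i" "ts ! Suc i \<le> T"
    using mono[of 0 i] mono[of i "Suc i"] mono[of "Suc i" "length ts - 1"] assms(2) ts by auto
qed

text \<open>
  The sums over a partition telescope.
\<close>

lemma total_variation_finite_of_hoelder:
  assumes "0 < p"
    and hoelder: "\<And>k. 1 \<le> k \<Longrightarrow> k \<le> N \<Longrightarrow>
      \<exists>C\<ge>0. \<forall>s t. 0 \<le> s \<and> s \<le> t \<and> t \<le> T \<longrightarrow> hs_norm k (Z s t) \<le> C * (t - s) powr (real k / p)"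
  shows "total_variation p T N Z < \<infinity>"
proof -
  have "(SUP ts\<in>partitions T. ennreal ((\<Sum>i<length ts - 1.
      hs_norm k (Z (ts ! i) (ts ! Suc i)) powr (p / real k)) powr (real k / p))) < \<infinity>"
    if k: "k \<in> {1..N}" for k
  proof -
    obtain C where C: "0 \<le> C" "\<And>s t. 0 \<le> s \<Longrightarrow> s \<le> t \<Longrightarrow> t \<le> T \<Longrightarrow> hs_norm k (Z s t) \<le> C * (t - s) powr (real k / p)"
      using hoelder[of k] k by auto
    have "(SUP ts\<in>partitions T. ennreal ((\<Sum>i<length ts - 1.
        hs_norm k (Z (ts ! i) (ts ! Suc i)) powr (p / real k)) powr (real k / p)))
        \<le> ennreal ((C powr (p / real k) * T) powr (real k / p))"
    proof (intro SUP_least ennreal_leI powr_mono2 sum_nonneg)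
      fix ts assume ts: "ts \<in> partitions T"
      let ?n = "length ts - 1"
      have "(\<Sum>i<?n. hs_norm k (Z (ts ! i) (ts ! Suc i)) powr (p / real k)) \<le>
          (\<Sum>i<?n. C powr (p / real k) * (ts ! Suc i - ts ! i))"
      proof (intro sum_mono)
        fix i assume "i \<in> {..<?n}"
        then have i: "0 \<le> ts ! i" "ts ! i \<le> ts ! Suc i" "ts ! Suc i \<le> T"
          using partitions_nth[OF ts] by auto
        have "hs_norm k (Z (ts ! i) (ts ! Suc i)) powr (p / real k) \<le>
            (C * (ts ! Suc i - ts ! i) powr (real k / p)) powr (p / real k)"
          using assms(1) by (intro powr_mono2 C i) auto
        also have "\<dots> = C powr (p / real k) * (ts ! Suc i - ts ! i)"
          using assms(1) C(1) i k by (simp add: powr_mult powr_powr)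
        finally show "hs_norm k (Z (ts ! i) (ts ! Suc i)) powr (p / real k) \<le> C powr (p / real k) * (ts ! Suc i - ts ! i)" .
      qed
      also have "\<dots> = C powr (p / real k) * (ts ! ?n - ts ! 0)"
        by (simp add: sum_lessThan_telescope flip: sum_distrib_left)
      also have "ts ! ?n - ts ! 0 = T"
        using ts by (auto simp: partitions_def hd_conv_nth last_conv_nth)
      finally show "(\<Sum>i<?n. hs_norm k (Z (ts ! i) (ts ! Suc i)) powr (p / real k)) \<le> C powr (p / real k) * T" .
    qed (use assms(1) in auto)
    then show ?thesis by (rule order.strict_trans1) simp
  qed
  then show ?thesis unfolding total_variation_def by (simp add: less_top)
qed

lemma variation_bounded_of_total_variation:
  assumes "total_variation p T N Z < \<infinity>" "1 \<le> k" "k \<le> N" "0 < p"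
  shows "\<exists>K. \<forall>ts\<in>partitions T. (\<Sum>i<length ts - 1. hs_norm k (Z (ts ! i) (ts ! Suc i)) powr (p / real k)) \<le> K"
proof -
  let ?V = "\<lambda>ts. \<Sum>i<length ts - 1. hs_norm k (Z (ts ! i) (ts ! Suc i)) powr (p / real k)"
  let ?S = "SUP ts\<in>partitions T. ennreal (?V ts powr (real k / p))"
  have "?S \<le> total_variation p T N Z"
    unfolding total_variation_def using assms
    by (intro member_le_sum[of k "{1..N}" "\<lambda>k. SUP ts\<in>partitions T. ennreal ((\<Sum>i<length ts - 1.
      hs_norm k (Z (ts ! i) (ts ! Suc i)) powr (p / real k)) powr (real k / p))"]) auto
  then have "?S < \<infinity>" using assms(1) by (simp add: order.strict_trans1)
  then obtain c where c: "0 \<le> c" "?S = ennreal c"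
    unfolding infinity_ennreal_def less_top_ennreal by blast
  have "?V ts \<le> c powr (p / real k)" if "ts \<in> partitions T" for ts
  proof -
    have "ennreal (?V ts powr (real k / p)) \<le> ennreal c"
      unfolding c(2)[symmetric] using that by (rule SUP_upper)
    then have "?V ts powr (real k / p) \<le> c" using c(1) by (simp add: ennreal_le_iff)
    then have "(?V ts powr (real k / p)) powr (p / real k) \<le> c powr (p / real k)"
      using assms by (intro powr_mono2) auto
    moreover have "0 \<le> ?V ts" by (simp add: sum_nonneg)
    ultimately show ?thesis using assms by (simp add: powr_powr)
  qed
  then show ?thesis by blast
qed

text \<open>
  For an exponent \<open>q < 1\<close> the increments over a fine partition satisfy
  \<open>\<Sum> \<bar>\<Delta>\<^sub>i\<bar> \<le> max \<bar>\<Delta>\<^sub>i\<bar>\<^bsup>1-q\<^esup> * \<Sum> \<bar>\<Delta>\<^sub>i\<bar>\<^sup>q\<close>, and the maximum tends to zero by uniform continuity.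
  Uniform partitions suffice, as their points are dense.
\<close>

lemma constant_of_small_variation:
  fixes f :: "real \<Rightarrow> real"
  assumes cont: "continuous_on {0..1} f" and q: "0 < q" "q < 1"
    and var: "\<And>N. 0 < N \<Longrightarrow> (\<Sum>i<N. \<bar>f (real (Suc i) / real N) - f (real i / real N)\<bar> powr q) \<le> K"
    and t: "0 \<le> t" "t \<le> 1"
  shows "f t = f 0"
proof -
  have "0 \<le> K" using var[of 1] by (rule order_trans[rotated]) (auto intro: sum_nonneg)
  have bound: "\<bar>f t - f 0\<bar> \<le> e + e powr (1 - q) * K" if "0 < e" for e
  proof -
    have "uniformly_continuous_on {0..1} f"
      using cont by (rule compact_uniformly_continuous) simp
    then obtain \<delta> where \<delta>: "0 < \<delta>" "\<And>x y. x \<in> {0..1} \<Longrightarrow> y \<in> {0..1} \<Longrightarrow> \<bar>y - x\<bar> < \<delta> \<Longrightarrow> \<bar>f y - f x\<bar> < e"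
      using \<open>0 < e\<close> unfolding uniformly_continuous_on_def dist_real_def by metis
    obtain j where j: "inverse (real (Suc j)) < \<delta>"
      using reals_Archimedean[OF \<delta>(1)] by blast
    define N where "N = Suc j"
    have N: "0 < N" "1 / real N < \<delta>"
      using j by (simp_all add: N_def inverse_eq_divide)
    define k where "k = nat \<lfloor>t * real N\<rfloor>"
    have "t * real N \<le> real N" using t by (simp add: mult_left_le_one_le)
    then have k: "real k \<le> t * real N" "t * real N < real k + 1" "k \<le> N"
      using t by (auto simp: k_def le_nat_iff nat_le_iff floor_le_iff)
    let ?d = "\<lambda>i. \<bar>f (real (Suc i) / real N) - f (real i / real N)\<bar>"
    have "?d i \<le> e powr (1 - q) * ?d i powr q" if "i < N" for i
    proof -
      have "?d i < e"
        using that N by (intro \<delta>) (auto simp: field_simps)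
      then have "?d i powr (1 - q) * ?d i powr q \<le> e powr (1 - q) * ?d i powr q"
        using q by (intro mult_right_mono powr_mono2) auto
      then show ?thesis by (simp flip: powr_add)
    qed
    then have "(\<Sum>i<k. ?d i) \<le> (\<Sum>i<N. e powr (1 - q) * ?d i powr q)"
      using k(3) by (intro order_trans[OF sum_mono2[of "{..<N}"] sum_mono]) auto
    also have "\<dots> \<le> e powr (1 - q) * K"
      unfolding sum_distrib_left[symmetric] by (intro mult_left_mono var N) auto
    finally have "(\<Sum>i<k. ?d i) \<le> e powr (1 - q) * K" .
    moreover have "f (real k / real N) - f 0 = (\<Sum>i<k. f (real (Suc i) / real N) - f (real i / real N))"
      using sum_lessThan_telescope[of "\<lambda>i. f (real i / real N)" k] by simp
    then have "\<bar>f (real k / real N) - f 0\<bar> \<le> (\<Sum>i<k. ?d i)"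
      by (simp only: sum_abs)
    moreover have "\<bar>f t - f (real k / real N)\<bar> < e"
    proof (rule \<delta>(2))
      have "\<bar>t - real k / real N\<bar> < 1 / real N"
      proof -
        have "t - real k / real N = (t * real N - real k) / real N"
          using N by (simp add: field_simps)
        then show ?thesis
          using k N by (simp add: divide_less_cancel)
      qed
      then show "\<bar>t - real k / real N\<bar> < \<delta>" using N by simp
    qed (use t k N in \<open>auto simp: field_simps\<close>)
    ultimately show ?thesis by linarith
  qed
  have "((\<lambda>e. e + e powr (1 - q) * K) \<longlongrightarrow> 0) (at_right 0)"
  proof -
    have "((\<lambda>e. e + e powr (1 - q) * K) \<longlongrightarrow> 0 + 0 powr (1 - q) * K) (at_right 0)"
      using q by (intro tendsto_intros tendsto_powr') (auto intro: eventually_mono[OF eventually_at_right_less])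
    then show ?thesis by simp
  qed
  then have "\<bar>f t - f 0\<bar> \<le> 0"
    by (rule tendsto_lowerbound) (auto intro!: eventually_at_rightI[of 0 1] bound)
  then show ?thesis by simp
qed

lemma uniform_partition:
  assumes "0 < N"
  defines "ts \<equiv> map (\<lambda>i. real i / real N) [0..<Suc N]"
  shows "ts \<in> partitions 1" "length ts - 1 = N" "\<And>i. i \<le> N \<Longrightarrow> ts ! i = real i / real N"
proof -
  have "ts ! i = real i / real N" if "i \<le> N" for i
    using that unfolding ts_def by (subst nth_map) (auto simp del: upt_Suc)
  then show "\<And>i. i \<le> N \<Longrightarrow> ts ! i = real i / real N" .
  show "length ts - 1 = N" by (simp add: ts_def)
  have "sorted_wrt (<) ts"
    unfolding ts_def sorted_wrt_map
    by (rule sorted_wrt_mono_rel[OF _ sorted_wrt_upt]) (use assms(1) in \<open>simp add: divide_strict_right_mono\<close>)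
  moreover have "ts \<noteq> []" "hd ts = 0" by (simp_all add: ts_def upt_conv_Cons del: upt_Suc)
  moreover have "last ts = 1" using assms(1) by (simp add: ts_def)
  ultimately show "ts \<in> partitions 1" by (simp add: partitions_def)
qed

lemma powr_add_le:
  fixes x y q :: real
  assumes "0 \<le> x" "0 \<le> y" "0 < q"
  shows "(x + y) powr q \<le> 2 powr q * (x powr q + y powr q)"
proof -
  have "(x + y) powr q \<le> (2 * max x y) powr q"
    using assms by (intro powr_mono2) auto
  also have "\<dots> = 2 powr q * (max x y) powr q"
    using assms by (simp add: powr_mult)
  also have "(max x y) powr q \<le> x powr q + y powr q"
    by (auto simp: max_def)
  finally show ?thesis by simp
qed

section \<open>The signature of an exponential path\<close>

context
  fixes E :: "'v::real_inner set"
  assumes E: "orthonormal_basis E"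
begin

lemma abs_form_le_hs_norm: "ws \<in> words E n \<Longrightarrow> \<bar>form \<xi> ws\<bar> \<le> hs_norm n \<xi>"
  using member_le_L2_set[OF finite_words[OF E], of ws n "\<lambda>ws. \<bar>form \<xi> ws\<bar>"]
  by (simp add: hs_norm_basis[OF E] L2_set_def)

lemma tendsto_hs_norm_diff:
  assumes "\<And>ws. length ws = n \<Longrightarrow> ((\<lambda>x. form (Z x) ws) \<longlongrightarrow> form (\<zeta> :: 'v tensor_series) ws) F"
  shows "((\<lambda>x. hs_norm n (Z x - \<zeta>)) \<longlongrightarrow> 0) F"
proof -
  have "((\<lambda>x. hs_norm n (Z x - \<zeta>)) \<longlongrightarrow> sqrt (\<Sum>ws\<in>words E n. (form \<zeta> ws - form \<zeta> ws)\<^sup>2)) F"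
    unfolding hs_norm_basis[OF E] L2_set_def form_simps
    by (intro tendsto_intros assms) auto
  then show ?thesis by simp
qed

lemma continuous_in_degree_exp:
  fixes \<xi> :: "'v tensor_series"
  assumes "form \<xi> [] = 0"
    and "\<And>s t ws. (s, t) \<in> time_simplex T \<Longrightarrow> length ws = n \<Longrightarrow> form (Z s t) ws = form (tensor_exp ((t - s) *\<^sub>R \<xi>)) ws"
  shows "continuous_in_degree n T Z"
proof -
  have "((\<lambda>z. hs_norm n (Z (fst z) (snd z) - Z s t)) \<longlongrightarrow> 0) (at (s, t) within time_simplex T)"
    if st: "(s, t) \<in> time_simplex T" for s t
  proof (rule tendsto_hs_norm_diff)
    fix ws :: "'v list" assume ws: "length ws = n"
    have form_Z: "form (Z s t) ws = (\<Sum>k\<le>n. (t - s) ^ k / fact k * form (\<xi> ^ k) ws)" if "(s, t) \<in> time_simplex T" for s t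
      using assms(2)[OF that ws] form_tensor_exp_finite[OF assms(1), of ws n] ws by simp
    have "((\<lambda>z. \<Sum>k\<le>n. (snd z - fst z) ^ k / fact k * form (\<xi> ^ k) ws) \<longlongrightarrow>
        (\<Sum>k\<le>n. (snd (s, t) - fst (s, t)) ^ k / fact k * form (\<xi> ^ k) ws)) (at (s, t) within time_simplex T)"
      by (intro tendsto_intros) auto
    then have "((\<lambda>z. \<Sum>k\<le>n. (snd z - fst z) ^ k / fact k * form (\<xi> ^ k) ws) \<longlongrightarrow> form (Z s t) ws) (at (s, t) within time_simplex T)"
      by (simp add: form_Z[OF st])
    then show "((\<lambda>z. form (Z (fst z) (snd z)) ws) \<longlongrightarrow> form (Z s t) ws) (at (s, t) within time_simplex T)"
    proof (rule Lim_transform_eventually)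
      show "\<forall>\<^sub>F z in at (s, t) within time_simplex T.
          (\<Sum>k\<le>n. (snd z - fst z) ^ k / fact k * form (\<xi> ^ k) ws) = form (Z (fst z) (snd z)) ws"
        unfolding eventually_at_filter by (rule always_eventually) (auto simp: form_Z)
    qed
  qed
  then show ?thesis
    by (auto simp: continuous_in_degree_def case_prod_unfold)
qed

text \<open>
  The component of degree \<open>k\<close> of \<open>\<xi>\<^sup>j\<close> vanishes unless \<open>j \<ge> k/b\<close>, and then \<open>\<tau>\<^sup>j \<le> \<tau>\<^bsup>k/b\<^esup>\<close>.
\<close>

lemma hs_norm_exp_hoelder:
  fixes \<xi> :: "'v tensor_series"
  assumes "form \<xi> [] = 0" and deg: "\<And>ws. b < length ws \<Longrightarrow> form \<xi> ws = 0" and "0 < b" "1 \<le> k"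
  shows "\<exists>C\<ge>0. \<forall>\<tau>. 0 \<le> \<tau> \<and> \<tau> \<le> 1 \<longrightarrow> hs_norm k (tensor_exp (\<tau> *\<^sub>R \<xi>)) \<le> C * \<tau> powr (real k / real b)"
proof (intro exI conjI allI impI)
  let ?C = "\<Sum>j\<le>k. hs_norm k (\<xi> ^ j) / fact j"
  show "0 \<le> ?C" by (intro sum_nonneg) auto
  fix \<tau> :: real assume \<tau>: "0 \<le> \<tau> \<and> \<tau> \<le> 1"
  have "hs_norm k (tensor_exp (\<tau> *\<^sub>R \<xi>)) = hs_norm k (\<Sum>j\<le>k. (\<tau> ^ j / fact j) *\<^sub>R \<xi> ^ j)"
    using form_tensor_exp_finite[OF assms(1), of _ k \<tau>] by (intro hs_norm_cong) (simp add: form_sum form_simps)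
  also have "\<dots> \<le> (\<Sum>j\<le>k. \<tau> ^ j / fact j * hs_norm k (\<xi> ^ j))"
    using \<tau> by (intro order_trans[OF hs_norm_sum_le]) (simp add: hs_norm_scaleR)
  also have "\<dots> \<le> (\<Sum>j\<le>k. \<tau> powr (real k / real b) * (hs_norm k (\<xi> ^ j) / fact j))"
  proof (intro sum_mono)
    fix j
    show "\<tau> ^ j / fact j * hs_norm k (\<xi> ^ j) \<le> \<tau> powr (real k / real b) * (hs_norm k (\<xi> ^ j) / fact j)"
    proof (cases "j * b < k")
      case True
      then have "hs_norm k (\<xi> ^ j) = 0"
        using hs_norm_cong[of k "\<xi> ^ j" 0] form_power_degree_gt[OF deg, where k = j] by (simp add: form_simps)
      then show ?thesis by simp
    next
      case False
      then have "0 < j" using \<open>1 \<le> k\<close> by (cases j) auto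
      have "real k \<le> real j * real b" using False by (metis not_less of_nat_le_iff of_nat_mult)
      then have "real k / real b \<le> real j" using \<open>0 < b\<close> by (simp add: field_simps)
      then have "\<tau> ^ j \<le> \<tau> powr (real k / real b)"
      proof (cases "\<tau> = 0")
        case False
        then have "\<tau> ^ j = \<tau> powr real j" using \<tau> by (simp add: powr_realpow)
        also have "\<dots> \<le> \<tau> powr (real k / real b)"
          using \<open>real k / real b \<le> real j\<close> \<tau> by (intro powr_mono') auto
        finally show ?thesis .
      qed (use \<open>0 < j\<close> in \<open>simp add: power_0_left\<close>)
      then have "\<tau> ^ j * (hs_norm k (\<xi> ^ j) / fact j) \<le> \<tau> powr (real k / real b) * (hs_norm k (\<xi> ^ j) / fact j)"
        by (intro mult_right_mono) auto
      then show ?thesis by simp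
    qed
  qed
  finally show "hs_norm k (tensor_exp (\<tau> *\<^sub>R \<xi>)) \<le> ?C * \<tau> powr (real k / real b)"
    by (simp add: sum_distrib_left mult.commute)
qed

lemma exp_lyons_extension:
  fixes \<xi> :: "'v tensor_series"
  assumes "form \<xi> [] = 0" and deg: "\<And>ws. b < length ws \<Longrightarrow> form \<xi> ws = 0" and "0 < b"
    and X: "\<And>s t. (s, t) \<in> time_simplex 1 \<Longrightarrow> X s t = trunc b (tensor_exp ((t - s) *\<^sub>R \<xi>))"
  shows "lyons_extension (real b) 1 X (\<lambda>s t. tensor_exp ((t - s) *\<^sub>R \<xi>))"
proof -
  let ?Y = "\<lambda>s t. tensor_exp ((t - s) *\<^sub>R \<xi>)"
  have mult: "?Y s u = ?Y s t * ?Y t u" for s t u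
    by (simp add: tensor_exp_add[OF assms(1)])
  have hoelder: "\<exists>C\<ge>0. \<forall>s t. 0 \<le> s \<and> s \<le> t \<and> t \<le> 1 \<longrightarrow> hs_norm k (?Y s t) \<le> C * (t - s) powr (real k / real b)"
    if "1 \<le> k" for k
    using hs_norm_exp_hoelder[OF assms(1) deg \<open>0 < b\<close> that] by (metis diff_ge_0_iff_ge diff_le_eq add_increasing2 order_trans)
  have XY: "hs_norm k (X s t) = hs_norm k (?Y s t)" if "k \<le> b" "0 \<le> s" "s \<le> t" "t \<le> 1" for k s t
    using that X[of s t] by (intro hs_norm_cong) (auto simp: time_simplex_def trunc.rep_eq)
  have "rough_path (real b) 1 X"
    unfolding rough_path_def
  proof (intro conjI allI impI)
    show "\<forall>(s, t)\<in>time_simplex 1. X s t \<in> truncated_algebra (nat \<lfloor>real b\<rfloor>) \<and> form (X s t) [] = 1"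
      using form_tensor_exp_finite[OF assms(1), of "[]" 0]
      by (auto simp: X truncated_algebra_def trunc_trunc trunc.rep_eq form_simps)
    show "continuous_in_degree n 1 X" if "n \<le> nat \<lfloor>real b\<rfloor>" for n
      using that by (intro continuous_in_degree_exp[OF assms(1)]) (auto simp: X trunc.rep_eq)
    show "X s u = trunc (nat \<lfloor>real b\<rfloor>) (X s t * X t u)" if "0 \<le> s \<and> s \<le> t \<and> t \<le> u \<and> u \<le> 1" for s t u
      using that tensor_exp_add[OF assms(1), of "t - s" "u - t"] by (simp add: X time_simplex_def trunc_mult)
    show "total_variation (real b) 1 (nat \<lfloor>real b\<rfloor>) X < \<infinity>"
    proof (rule total_variation_finite_of_hoelder)
      fix k assume k: "1 \<le> k" "k \<le> nat \<lfloor>real b\<rfloor>"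
      show "\<exists>C\<ge>0. \<forall>s t. 0 \<le> s \<and> s \<le> t \<and> t \<le> 1 \<longrightarrow> hs_norm k (X s t) \<le> C * (t - s) powr (real k / real b)"
        using hoelder[OF k(1)] XY[of k] k(2) by simp
    qed (use \<open>0 < b\<close> in simp)
  qed (use \<open>0 < b\<close> in simp)
  moreover have "total_variation (real b) 1 N ?Y < \<infinity>" for N
    using hoelder \<open>0 < b\<close> by (intro total_variation_finite_of_hoelder) auto
  moreover have "continuous_in_degree n 1 ?Y" for n
    by (rule continuous_in_degree_exp[OF assms(1)]) simp
  ultimately show ?thesis
    unfolding lyons_extension_def using X mult by auto
qed

text \<open>
  When two multiplicative functionals agree in all lower degrees, the mixed terms of their products cancel.
\<close>

lemma increment_additive:
  fixes Y Z :: "real \<Rightarrow> real \<Rightarrow> 'v tensor_series"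
  assumes mult: "Y s u = Y s t * Y t u" "Z s u = Z s t * Z t u"
    and eq: "\<And>us. length us < n \<Longrightarrow> form (Y s t) us = form (Z s t) us"
      "\<And>us. length us < n \<Longrightarrow> form (Y t u) us = form (Z t u) us"
    and unit: "form (Z s t) [] = 1" "form (Z t u) [] = 1"
    and ws: "length ws = n" "0 < n"
  shows "form (Y s u - Z s u) ws = form (Y s t - Z s t) ws + form (Y t u - Z t u) ws"
proof -
  let ?d = "\<lambda>k. form (Y s t) (take k ws) * form (Y t u) (drop k ws) - form (Z s t) (take k ws) * form (Z t u) (drop k ws)"
  have "form (Y s u - Z s u) ws = (\<Sum>k\<le>n. ?d k)"
    unfolding mult form_simps by (simp add: ws sum_subtractf)
  also have "\<dots> = (\<Sum>k\<in>{0, n}. ?d k)"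
    using ws eq by (intro sum.mono_neutral_right) auto
  also have "\<dots> = form (Y s t - Z s t) ws + form (Y t u - Z t u) ws"
    using ws unit eq(1)[of "[]"] eq(2)[of "[]"] by (simp add: form_simps)
  finally show ?thesis .
qed

lemma continuous_on_form:
  fixes Y :: "real \<Rightarrow> real \<Rightarrow> 'v tensor_series"
  assumes "continuous_in_degree n T Y" "ws \<in> words E n"
  shows "continuous_on {0..T} (\<lambda>t. form (Y 0 t) ws)"
  unfolding continuous_on_def
proof
  fix t assume t: "t \<in> {0..T}"
  then have "((\<lambda>(u, v). hs_norm n (Y u v - Y 0 t)) \<longlongrightarrow> 0) (at (0, t) within time_simplex T)"
    using assms(1) by (auto simp: continuous_in_degree_def time_simplex_def)
  moreover have "filterlim (\<lambda>v. (0, v)) (at (0, t) within time_simplex T) (at t within {0..T})"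
    unfolding filterlim_at
    by (auto simp: eventually_at_filter time_simplex_def intro!: tendsto_intros always_eventually)
  ultimately have lim: "((\<lambda>v. hs_norm n (Y 0 v - Y 0 t)) \<longlongrightarrow> 0) (at t within {0..T})"
    using filterlim_compose by fastforce
  have "((\<lambda>v. form (Y 0 v) ws - form (Y 0 t) ws) \<longlongrightarrow> 0) (at t within {0..T})"
    using abs_form_le_hs_norm[OF assms(2), of "Y 0 _ - Y 0 t"]
    by (intro Lim_null_comparison[OF _ lim] always_eventually) (auto simp: form_simps)
  then show "((\<lambda>t. form (Y 0 t) ws) \<longlongrightarrow> form (Y 0 t) ws) (at t within {0..T})"
    by (rule LIM_zero_cancel)
qed

text \<open>
  By induction on the degree \<open>n\<close>. Up to degree \<open>p\<close> both extensions are given by \<open>X\<close>. Beyond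
  degree \<open>p\<close>, the difference of two extensions that agree in lower degrees is the increment of a continuous function with finite variation of exponent \<open>p/n < 1\<close>, hence zero.
\<close>

lemma lyons_extension_unique:
  fixes Y Z :: "real \<Rightarrow> real \<Rightarrow> 'v tensor_series"
  assumes Y: "lyons_extension p 1 X Y" and Z: "lyons_extension p 1 X Z"
    and st: "0 \<le> s" "s \<le> t" "t \<le> 1"
  shows "Y s t = Z s t"
proof -
  have p: "1 \<le> p" using Y by (simp add: lyons_extension_def rough_path_def)
  define m where "m = nat \<lfloor>p\<rfloor>"
  have trunc_eq: "trunc m (Y s t) = trunc m (Z s t)" if "0 \<le> s" "s \<le> t" "t \<le> 1" for s t
    using Y Z that by (auto simp: lyons_extension_def time_simplex_def m_def)
  have unit: "form (Z s t) [] = 1" if st: "0 \<le> s" "s \<le> t" "t \<le> 1" for s t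
  proof -
    have "trunc m (Z s t) = X s t" "form (X s t) [] = 1"
      using Z st by (auto simp: lyons_extension_def rough_path_def time_simplex_def m_def)
    then show ?thesis by (metis trunc.rep_eq le0 list.size(3))
  qed
  have mult: "Y s u = Y s t * Y t u" "Z s u = Z s t * Z t u" if "0 \<le> s" "s \<le> t" "t \<le> u" "u \<le> 1" for s t u
    using Y Z that by (auto simp: lyons_extension_def)
  have "\<forall>s t ws. 0 \<le> s \<and> s \<le> t \<and> t \<le> 1 \<and> length ws = n \<longrightarrow> form (Y s t) ws = form (Z s t) ws" for n
  proof (induction n rule: less_induct)
    case (less n)
    show ?case
    proof (cases "n \<le> m")
      case True
      then show ?thesis using trunc_eq by (metis trunc.rep_eq)
    next
      case False
      then have pn: "p < real n" and n: "1 \<le> n" using p by (auto simp: m_def) linarith+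
      define q where "q = p / real n"
      have q: "0 < q" "q < 1" using p pn by (auto simp: q_def)
      obtain KY KZ where
        KY: "\<And>ts. ts \<in> partitions 1 \<Longrightarrow> (\<Sum>i<length ts - 1. hs_norm n (Y (ts ! i) (ts ! Suc i)) powr q) \<le> KY" and
        KZ: "\<And>ts. ts \<in> partitions 1 \<Longrightarrow> (\<Sum>i<length ts - 1. hs_norm n (Z (ts ! i) (ts ! Suc i)) powr q) \<le> KZ"
        using variation_bounded_of_total_variation[of p 1 n Y n] variation_bounded_of_total_variation[of p 1 n Z n]
          Y Z n p unfolding lyons_extension_def q_def by auto
      have add: "form (Y s u - Z s u) ws = form (Y s t - Z s t) ws + form (Y t u - Z t u) ws"
        if "0 \<le> s" "s \<le> t" "t \<le> u" "u \<le> 1" "length ws = n" for s t u ws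
        using that less n by (intro increment_additive[where n = n] mult unit) auto
      have "form (Y s t - Z s t) ws = 0" if st: "0 \<le> s" "s \<le> t" "t \<le> 1" and "length ws = n" for s t ws
      proof (rule form_eq_0_of_basis[OF E _ \<open>length ws = n\<close>])
        fix ws assume ws: "ws \<in> words E n"
        define f where "f t = form (Y 0 t - Z 0 t) ws" for t
        have f_diff: "f t - f s = form (Y s t - Z s t) ws" if "0 \<le> s" "s \<le> t" "t \<le> 1" for s t
          using add[of 0 s t ws] that ws by (simp add: f_def)
        have "f t = f 0" if t: "0 \<le> t" "t \<le> 1" for t
        proof (rule constant_of_small_variation[OF _ q _ t])
          show "continuous_on {0..1} f"
            unfolding f_def form_simps using Y Z ws
            by (intro continuous_intros continuous_on_form) (auto simp: lyons_extension_def)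
          fix N :: nat assume "0 < N"
          define ts where "ts = map (\<lambda>i. real i / real N) [0..<Suc N]"
          note ts = uniform_partition[OF \<open>0 < N\<close>, folded ts_def]
          have "\<bar>f (real (Suc i) / real N) - f (real i / real N)\<bar> powr q \<le>
              2 powr q * (hs_norm n (Y (ts ! i) (ts ! Suc i)) powr q + hs_norm n (Z (ts ! i) (ts ! Suc i)) powr q)"
            if "i < N" for i
          proof -
            have i: "0 \<le> ts ! i" "ts ! i \<le> ts ! Suc i" "ts ! Suc i \<le> 1"
              using partitions_nth[OF ts(1), of i] ts(2) that by auto
            have "\<bar>f (ts ! Suc i) - f (ts ! i)\<bar> \<le> hs_norm n (Y (ts ! i) (ts ! Suc i) - Z (ts ! i) (ts ! Suc i))"
              unfolding f_diff[OF i] by (rule abs_form_le_hs_norm[OF ws])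
            also have "\<dots> \<le> hs_norm n (Y (ts ! i) (ts ! Suc i)) + hs_norm n (Z (ts ! i) (ts ! Suc i))"
              by (rule hs_norm_diff_le)
            finally have "\<bar>f (ts ! Suc i) - f (ts ! i)\<bar> powr q \<le>
                (hs_norm n (Y (ts ! i) (ts ! Suc i)) + hs_norm n (Z (ts ! i) (ts ! Suc i))) powr q"
              using q by (intro powr_mono2) auto
            also have "\<dots> \<le> 2 powr q * (hs_norm n (Y (ts ! i) (ts ! Suc i)) powr q + hs_norm n (Z (ts ! i) (ts ! Suc i)) powr q)"
              using q by (intro powr_add_le) auto
            finally show ?thesis using that by (simp add: ts(3))
          qed
          then have "(\<Sum>i<N. \<bar>f (real (Suc i) / real N) - f (real i / real N)\<bar> powr q) \<le>
              2 powr q * ((\<Sum>i<N. hs_norm n (Y (ts ! i) (ts ! Suc i)) powr q) + (\<Sum>i<N. hs_norm n (Z (ts ! i) (ts ! Suc i)) powr q))"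
            unfolding sum.distrib[symmetric] sum_distrib_left by (intro sum_mono) auto
          also have "\<dots> \<le> 2 powr q * (KY + KZ)"
            using KY[OF ts(1)] KZ[OF ts(1)] unfolding ts(2) by (intro mult_left_mono add_mono) auto
          finally show "(\<Sum>i<N. \<bar>f (real (Suc i) / real N) - f (real i / real N)\<bar> powr q) \<le> 2 powr q * (KY + KZ)" .
        qed
        then show "form (Y s t - Z s t) ws = 0"
          using f_diff[OF st] st by (metis diff_self order_trans)
      qed
      then show ?thesis by (simp add: form_simps)
    qed
  qed
  then show ?thesis using st by (intro tensor_series_eqI) blast
qed

lemma signature_exp:
  fixes \<xi> :: "'v tensor_series"
  assumes "form \<xi> [] = 0" and deg: "\<And>ws. b < length ws \<Longrightarrow> form \<xi> ws = 0" and "0 < b"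
    and x: "\<And>t. 0 \<le> t \<Longrightarrow> t \<le> 1 \<Longrightarrow> x t = truncated_exp b (t *\<^sub>R \<xi>)"
  shows "signature (real b) 1 (path_increments b x) = tensor_exp \<xi>"
proof -
  let ?Y = "\<lambda>s t. tensor_exp ((t - s) *\<^sub>R \<xi>)"
  have ext: "lyons_extension (real b) 1 (path_increments b x) ?Y"
    using assms(1-3) by (rule exp_lyons_extension)
      (auto simp: time_simplex_def intro!: path_increments_exp[OF assms(1)] x)
  show ?thesis
    unfolding signature_def
  proof (rule the_equality)
    show "\<exists>Y. lyons_extension (real b) 1 (path_increments b x) Y \<and> tensor_exp \<xi> = Y 0 1"
      using ext by (intro exI[of _ ?Y]) simp
    show "S = tensor_exp \<xi>" if "\<exists>Y. lyons_extension (real b) 1 (path_increments b x) Y \<and> S = Y 0 1" for S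
      using that lyons_extension_unique[OF _ ext, of _ 0 1] by auto
  qed
qed

end

section \<open>Tail asymptotics of the signature\<close>

theorem theorem3p1:
  fixes l\<^sub>a l\<^sub>b :: "'v::real_inner tensor_series"
    and X :: "real \<Rightarrow> 'v tensor_series"
    and a b :: nat
  assumes "\<exists>B :: 'v set. finite B \<and> span B = UNIV"
    and "1 \<le> a" and "a < b"
    and "l\<^sub>a \<in> homogeneous_lie a" and "l\<^sub>b \<in> homogeneous_lie b"
    and "\<And>t. 0 \<le> t \<Longrightarrow> t \<le> 1 \<Longrightarrow> X t = truncated_exp b (t *\<^sub>R (l\<^sub>a + l\<^sub>b))"
    and "odd ((b - a) div gcd a b)"
  shows "signature_tail (real b) 1 (path_increments b X) = ereal (hs_norm b l\<^sub>b)"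
proof -
  obtain E :: "'v set" where E: "orthonormal_basis E"
    using orthonormal_basis_exists[OF assms(1)] by blast
  have l: "l\<^sub>a \<in> tensor_power a" "l\<^sub>b \<in> tensor_power b"
    using assms(4,5) homogeneous_lie_subset_tensor_power by blast+
  have "signature (real b) 1 (path_increments b X) = tensor_exp (l\<^sub>a + l\<^sub>b)"
    using assms(2,3,6) l by (intro signature_exp[OF E]) (auto simp: form_simps tensor_power_degree)
  then show ?thesis
    unfolding signature_tail_def
    using limsup_exp_two_homogeneous[OF E l] assms(2,3) by simp
qed

end
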